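(* Let $u$ be a finite sequence. Then $\operatorname{Sat}(n,u)=O(n)$ as $n\to\infty$ (with implied constant depending only on $u$) in each of the following cases: (1) $u$ is of the form $abcabc\cdots$, i.e. $u$ is one of $(abc)^t$, $(abc)^ta$, $(abc)^tab$ for some integer $t\ge 1$, where $a,b,c$ are distinct letters; (2) $u$ is of the form $aa\dots bb$ (the first two letters of $u$ are equal to each other, and the last two letters of $u$ are equal to each other), and $u$ cannot be decomposed as a concatenation $u=u_1u_2$ of two nonempty sequences having no letters in common; (3) $u=abc\dots xyz$ is a sequence with exactly three distinct letters, whose first three letters $a,b,c$ (in this order) are distinct, whose last three letters $x,y,z$ (in this order) satisfy $xyz\in\{abc,\,bca,\,cab\}$, and which satisfies $f_0(u)\ge f_1(u)+5$.
   Context: For a sequence $s$, $s^t$ denotes the concatenation of $t$ copies of $s$. Let $r$ be the number of distinct letters of the finite sequence $u$. Two sequences are isomorphic if one is obtained from the other by a one-to-one renaming of letters. A copy of $u$ in a sequence $s$ is a (not necessarily contiguous) subsequence of $s$ isomorphic to $u$; $s$ avoids $u$ if it contains no copy of $u$. A sequence is $r$-sparse if any $r$ consecutive letters in it are pairwise distinct. A finite sequence $s$ with letters in an alphabet $A$ is $u$-saturated if $s$ is $r$-sparse, $s$ avoids $u$, and inserting any letter of $A$ at any position of $s$ (including the beginning and the end) yields a sequence that is not $r$-sparse or that contains a copy of $u$. $\operatorname{Sat}(n,u)$ is the minimum length of a $u$-saturated sequence over an alphabet of $n$ letters. For a three-letter sequence $u$ whose first three letters $a,b,c$ are distinct, $f_0(u)$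 is the number of pairs of consecutive letters of $u$ (i.e. indices $k$ and pairs $u_ku_{k+1}$) of the form $ab$, $bc$ or $ca$, and $f_1(u)$ is the number of pairs of consecutive letters of $u$ of the form $ac$, $ba$ or $cb$. *)

theory Defs
  imports Complex_Main "HOL-Library.Sublist" "HOL-Library.Landau_Symbols"
begin

definition isomorphic_seq :: "'a list \<Rightarrow> 'b list \<Rightarrow> bool" where
  "isomorphic_seq u v \<longleftrightarrow> (\<exists>f. inj_on f (set u) \<and> v = map f u)"

definition avoids :: "'b list \<Rightarrow> 'a list \<Rightarrow> bool" where
  "avoids s u \<longleftrightarrow> \<not> (\<exists>v. subseq v s \<and> isomorphic_seq u v)"

text \<open>
  Blocks of \<^emph>\<open>at most\<close> \<open>r\<close> consecutive letters are considered, so that equal letters are always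
  at distance at least \<open>r\<close>. This differs from asking for blocks of exactly \<open>r\<close> letters only for
  sequences shorter than \<open>r\<close>. With exactly \<open>r\<close>, for \<open>r \<ge> 3\<close> the sequence \<open>a\<^sup>r\<^sup>-\<^sup>1\<close> would vacuously
  be \<open>r\<close>-sparse while none of its one-letter extensions is, which would make it saturated.
\<close>

definition sparse :: "nat \<Rightarrow> 'a list \<Rightarrow> bool" where
  "sparse r s \<longleftrightarrow> (\<forall>w. sublist w s \<and> length w \<le> r \<longrightarrow> distinct w)"

definition saturated :: "'b set \<Rightarrow> 'a list \<Rightarrow> 'b list \<Rightarrow> bool" where
  "saturated A u s \<longleftrightarrow>
     set s \<subseteq> A \<and> sparse (card (set u)) s \<and> avoids s u \<and>
     (\<forall>p q x. s = p @ q \<and> x \<in> A \<longrightarrow>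
        \<not> sparse (card (set u)) (p @ x # q) \<or> \<not> avoids (p @ x # q) u)"

text \<open>
  The minimum is over a nonempty set whenever \<open>u \<noteq> []\<close>; see \<open>Sat_attained\<close> below. The choice of
  the \<open>n\<close>-letter alphabet is immaterial.
\<close>

definition Sat :: "nat \<Rightarrow> 'a list \<Rightarrow> nat" where
  "Sat n u = Inf (length ` {s :: nat list. saturated {..<n} u s})"

definition seq_power :: "'a list \<Rightarrow> nat \<Rightarrow> 'a list" where
  "seq_power s t = concat (replicate t s)"

definition decomposable :: "'a list \<Rightarrow> bool" where
  "decomposable u \<longleftrightarrow>
     (\<exists>u1 u2. u = u1 @ u2 \<and> u1 \<noteq> [] \<and> u2 \<noteq> [] \<and> set u1 \<inter> set u2 = {})"

definition f0 :: "'a list \<Rightarrow> nat" where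
  "f0 u = (let a = u ! 0; b = u ! 1; c = u ! 2 in
     card {k. Suc k < length u \<and> (u ! k, u ! Suc k) \<in> {(a, b), (b, c), (c, a)}})"

definition f1 :: "'a list \<Rightarrow> nat" where
  "f1 u = (let a = u ! 0; b = u ! 1; c = u ! 2 in
     card {k. Suc k < length u \<and> (u ! k, u ! Suc k) \<in> {(a, c), (b, a), (c, b)}})"

definition alternating_abc :: "'a list \<Rightarrow> bool" where
  "alternating_abc u \<longleftrightarrow> (\<exists>a b c t. distinct [a, b, c] \<and> t \<ge> 1 \<and>
     u \<in> {seq_power [a, b, c] t, seq_power [a, b, c] t @ [a], seq_power [a, b, c] t @ [a, b]})"

text \<open>The letters \<open>a\<close> and \<open>b\<close> may coincide, and the two end pairs may overlap.\<close>

definition doubled_ends :: "'a list \<Rightarrow> bool" where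
  "doubled_ends u \<longleftrightarrow> (\<exists>a v. u = [a, a] @ v) \<and> (\<exists>b w. u = w @ [b, b])"

definition cyclic_abc_xyz :: "'a list \<Rightarrow> bool" where
  "cyclic_abc_xyz u \<longleftrightarrow> card (set u) = 3 \<and>
     (\<exists>a b c x y z v w. distinct [a, b, c] \<and> u = [a, b, c] @ v \<and> u = w @ [x, y, z] \<and>
        [x, y, z] \<in> {[a, b, c], [b, c, a], [c, a, b]})"

lemma chunks_exist:
  "M * r \<le> length s \<Longrightarrow>
   \<exists>cs. length cs = M \<and> (\<forall>c\<in>set cs. length c = r \<and> sublist c s) \<and> subseq (concat cs) s"
proof (induction M arbitrary: s)
  case 0
  then show ?case by (intro exI[of _ "[]"]) auto
next
  case (Suc M)
  have "M * r \<le> length (drop r s)" using Suc.prems by simp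
  from Suc.IH[OF this] obtain cs where cs: "length cs = M"
    "\<forall>c\<in>set cs. length c = r \<and> sublist c (drop r s)" "subseq (concat cs) (drop r s)" by blast
  have "\<forall>c\<in>set cs. sublist c s"
    using cs(2) sublist_drop sublist_order.order_trans by blast
  moreover have "subseq (take r s @ concat cs) s"
    using list_emb_append_mono[OF subseq_order.refl[of "take r s"] cs(3)] by simp
  ultimately show ?case
    using cs Suc.prems by (intro exI[of _ "take r s # cs"]) (auto simp: sublist_take)
qed

lemma subseq_concat: "subseq xs ys \<Longrightarrow> subseq (concat xs) (concat ys)"
proof (induction rule: list_emb.induct)
  case (list_emb_Cons xs ys y)
  then show ?case by (simp add: subseq_drop_many)
next
  case (list_emb_Cons2 x y xs ys)
  then show ?case by (auto intro: list_emb_append_mono)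
qed auto

lemma subseq_concat_replicate:
  "set v \<subseteq> set w \<Longrightarrow> subseq v (concat (replicate (length v) w))"
proof (induction v)
  case (Cons x v)
  have "subseq [x] w" using Cons.prems by (simp add: subseq_singleton_left)
  from list_emb_append_mono[OF this Cons.IH] Cons.prems show ?case by simp
qed simp

lemma sparse_avoids_length_bound:
  fixes u :: "'a list" and A :: "'b set"
  assumes "finite A" "u \<noteq> []"
  shows "\<exists>N. \<forall>s. set s \<subseteq> A \<and> sparse (card (set u)) s \<and> avoids s u \<longrightarrow> length s \<le> N"
proof -
  define r where "r = card (set u)"
  define W where "W = {w. set w \<subseteq> A \<and> length w = r}"
  define M where "M = card W * length u + 1"
  have finW: "finite W" unfolding W_def by (rule finite_lists_length_eq[OF assms(1)])
  have "length s \<le> M * r" if s: "set s \<subseteq> A" "sparse r s" "avoids s u" for s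
  proof (rule ccontr)
    assume "\<not> length s \<le> M * r"
    then obtain cs where cs: "length cs = M" "\<forall>c\<in>set cs. length c = r \<and> sublist c s"
      "subseq (concat cs) s" using chunks_exist[of M r s] by auto
    have sub: "set cs \<subseteq> W" using cs(2) s(1) by (auto simp: W_def dest: set_mono_sublist)
    have "\<exists>w\<in>set cs. length u \<le> count_list cs w"
    proof (rule ccontr)
      assume "\<not> ?thesis"
      then have "(\<Sum>w\<in>set cs. count_list cs w) \<le> card (set cs) * length u"
        by (intro sum_bounded_above[where 'a = nat, simplified]) force
      also have "\<dots> \<le> card W * length u" using card_mono[OF finW sub] by simp
      finally show False using cs(1) sum_count_set[of cs "set cs"] by (simp add: M_def)
    qed
    then obtain w where w: "w \<in> set cs" "length u \<le> count_list cs w" by blast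
    have "distinct w" using cs(2) w(1) s(2) by (auto simp: sparse_def)
    then have "card (set w) = card (set u)" using cs(2) w(1) by (simp add: distinct_card r_def)
    then obtain f where f: "bij_betw f (set u) (set w)"
      using finite_same_card_bij[of "set u" "set w"] by auto
    have filt: "filter ((=) w) cs = replicate (count_list cs w) w"
      by (induction cs) auto
    have "subseq (map f u) (concat (replicate (length u) w))"
      using subseq_concat_replicate[of "map f u" w] f by (simp add: bij_betw_def)
    also have "subseq \<dots> (concat (replicate (count_list cs w) w))"
      using w(2) by (intro subseq_concat) (metis le_add_diff_inverse list_emb_append2 replicate_add
        subseq_order.order_refl subseq_rev_drop_many)
    also have "subseq \<dots> (concat cs)"
      using subseq_concat[OF subseq_filter_left[of "(=) w" cs]] filt by simp
    also note cs(3)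
    finally have "subseq (map f u) s" .
    moreover have "isomorphic_seq u (map f u)"
      using f by (auto simp: isomorphic_seq_def bij_betw_def)
    ultimately show False using s(3) by (auto simp: avoids_def)
  qed
  then show ?thesis unfolding r_def by blast
qed

lemma saturated_exists:
  fixes u :: "'a list" and A :: "'b set"
  assumes "finite A" "u \<noteq> []"
  shows "\<exists>s. saturated A u s"
proof -
  define P where "P s \<longleftrightarrow> set s \<subseteq> A \<and> sparse (card (set u)) s \<and> avoids s u" for s :: "'b list"
  have P0: "P []" using assms(2) by (auto simp: P_def sparse_def avoids_def isomorphic_seq_def)
  obtain N where N: "\<And>s. P s \<Longrightarrow> length s \<le> N"
    using sparse_avoids_length_bound[OF assms] unfolding P_def by blast
  obtain s where s: "P s" "\<And>t. P t \<Longrightarrow> length t \<le> length s"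
    using ex_has_greatest_nat[of P "[]" length "Suc N"] P0 N by (auto simp: less_Suc_eq_le)
  have "\<not> P (p @ x # q)" if "s = p @ q" for p q x
    using s(2)[of "p @ x # q"] that by auto
  then have "saturated A u s"
    using s(1) unfolding saturated_def P_def by auto
  then show ?thesis ..
qed

lemma Sat_attained:
  assumes "u \<noteq> []"
  shows "\<exists>s. saturated {..<n} u s \<and> length s = Sat n u"
proof -
  have "length ` {s :: nat list. saturated {..<n} u s} \<noteq> {}"
    using saturated_exists[OF finite_lessThan assms] by auto
  from Inf_nat_def1[OF this] show ?thesis by (auto simp: Sat_def)
qed

end

theory Submission imports Defs "HOL-Number_Theory.Cong" begin

text \<open>
  Start from a seed, a sparse sequence \<open>s\<close> that avoids \<open>u\<close>, and insert letters until the result is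
  saturated. The result is short if the seed is already nearly saturated: if \<open>s\<close> is cut into
  \<open>O(n)\<close> blocks so that at each block all but a bounded number of letters would create a copy of
  \<open>u\<close>, then what ends up at one block is a sparse \<open>u\<close>-avoiding sequence over boundedly many
  letters, hence of bounded length (\<open>Sat_linear_by_blocks\<close>). It remains to find seeds.

  Both seeds are made of periodic words \<open>x\<^sub>0x\<^sub>1\<dots>x\<^sub>r\<^sub>-\<^sub>1x\<^sub>0x\<^sub>1\<dots>\<close> with \<open>r\<close> the number of letters of \<open>u\<close>.
  Once the letters of \<open>u\<close> are placed on a cycle of length \<open>r\<close>, \<open>u\<close> is a subsequence of such a word
  exactly when the word, begun at the right letter, is longer than the total distance that \<open>u\<close>
  travels forward around the cycle (\<open>travel\<close>).

  If \<open>u = aa\<dots>bb\<close> is indecomposable, take disjoint alphabets of \<open>r\<close> letters, and over each of them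
  the longest periodic word that avoids \<open>u\<close> however its letters are placed on the cycle. A copy
  of \<open>u\<close> would have to lie in one block, so the seed avoids \<open>u\<close>. A letter \<open>x\<close> inserted anywhere
  before its block can play the first \<open>a\<close>: the step from this \<open>a\<close> to the next costs a full turn of
  the cycle, and the turn saved pays for waiting until \<open>x\<close> appears in the block
  (\<open>doubled_start_copy\<close>). The other end is symmetric.

  If \<open>u = abc\<dots>xyz\<close> has three letters, the seed repeats its last three letters cyclically, and
  each time the next letter would complete a copy of \<open>u\<close>, a new letter takes the place of that
  letter for good (\<open>renewal\<close>). So a letter inserted well before its first or well after its last
  occurrence extends a periodic word by the one letter that is missing for a copy. Conversely, a
  copy in the seed uses three letters, all of which occur among its first three and among its last
  three terms, so that, except for two terms at each end, it lies where just these three letters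
  are in use; this stretch is too short (\<open>renewal_avoids\<close>). Here a copy might also run around
  the cycle backwards. By the hypothesis on \<open>f0\<close> and \<open>f1\<close>, \<open>u\<close> travels at least four units more
  backwards than forwards, which makes up for the four additional units that its first two and last
  two steps cost in that direction.

  Alternating sequences of length at least five are of this kind, with \<open>f1 u = 0\<close>. A sparse sequence
  that avoids \<open>abc\<close> or \<open>abca\<close> has no repeated letter.
\<close>

section \<open>Words on a cycle\<close>

text \<open>
  The number of moves from \<open>i\<close> forward to \<open>j\<close> on the cycle of length \<open>r\<close>. It lies between \<open>1\<close> and
  \<open>r\<close>: staying at \<open>i\<close> costs a full turn, because a periodic word shows the same letter again only
  \<open>r\<close> places later.
\<close>

definition step :: "nat \<Rightarrow> nat \<Rightarrow> nat \<Rightarrow> nat" where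
  "step r i j = (if i < j then j - i else j + r - i)"

fun travel :: "nat \<Rightarrow> nat list \<Rightarrow> nat" where
  "travel r (x # y # w) = step r x y + travel r (y # w)"
| "travel r w = 0"

lemma step_le_diff:
  assumes "i < j" "r > 0"
  shows "i + step r (i mod r) (j mod r) \<le> j"
proof -
  define a q b p where "a = i mod r" "q = i div r" "b = j mod r" "p = j div r"
  have i: "i = q * r + a" and j: "j = p * r + b" and ab: "a < r" "b < r"
    using assms(2) by (auto simp: a_q_b_p_def)
  have "q \<le> p" using assms(1) by (simp add: a_q_b_p_def div_le_mono)
  show ?thesis
  proof (cases "a < b")
    case True
    then show ?thesis using \<open>q \<le> p\<close> mult_le_mono1[of q p r] i j
      unfolding a_q_b_p_def(1,3)[symmetric] by (simp add: step_def)
  next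
    case False
    have "q \<noteq> p" using assms(1) i j False by auto
    then have "(q + 1) * r \<le> p * r" using \<open>q \<le> p\<close> by (intro mult_le_mono1) auto
    then show ?thesis using False i j ab
      unfolding a_q_b_p_def(1,3)[symmetric] by (simp add: step_def)
  qed
qed

lemma step_add_mod:
  assumes "t mod r = x" "x < r" "y < r"
  shows "(t + step r x y) mod r = y"
proof -
  have "(t + step r x y) mod r = (x + step r x y) mod r"
    using assms(1) by (metis mod_add_left_eq)
  then show ?thesis using assms(2,3) by (auto simp: step_def)
qed

lemma step_pos: "x < r \<Longrightarrow> 0 < step r x y"
  by (auto simp: step_def)

lemma step_le: "x < r \<Longrightarrow> y < r \<Longrightarrow> step r x y \<le> r"
  by (auto simp: step_def)

lemma travel_ge_length:
  "set w \<subseteq> {..<r} \<Longrightarrow> length w \<le> Suc (travel r w)"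
proof (induction r w rule: travel.induct)
  case (1 r x y w)
  then show ?case using step_pos[of x r y] by auto
qed auto

lemma travel_append:
  assumes "v \<noteq> []" "w \<noteq> []"
  shows "travel r (v @ w) = travel r v + step r (last v) (hd w) + travel r w"
  using assms(1)
proof (induction v rule: induct_list012)
  case (2 x)
  then show ?case using assms(2) by (cases w) auto
qed auto

lemma travel_conv_sum:
  "travel r w = (\<Sum>k<length w - 1. step r (w ! k) (w ! Suc k))"
proof (induction r w rule: travel.induct)
  case (1 r x y w)
  then show ?case by (simp add: sum.lessThan_Suc_shift del: sum.lessThan_Suc)
qed auto

text \<open>
  Increasing times whose residues spell a word must last as long as the word travels. With
  \<open>schedule_exists\<close>, which attains this bound from any starting time of the right residue, it decides
  which words are subsequences of a periodic word.
\<close>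

lemma travel_le_span:
  assumes "sorted_wrt (<) ts" "ts \<noteq> []" "r > 0"
  shows "hd ts + travel r (map (\<lambda>t. t mod r) ts) \<le> last ts"
  using assms(1,2)
proof (induction ts rule: induct_list012)
  case (3 s t ts)
  have "s + step r (s mod r) (t mod r) \<le> t"
    using 3(3) assms(3) by (intro step_le_diff) auto
  then show ?case using 3 by auto
qed auto

lemma schedule_exists:
  assumes "w \<noteq> []" "set w \<subseteq> {..<r}" "t mod r = hd w"
  shows "\<exists>ts. sorted_wrt (<) ts \<and> ts \<noteq> [] \<and> map (\<lambda>t. t mod r) ts = w \<and>
           hd ts = t \<and> last ts = t + travel r w"
  using assms
proof (induction w arbitrary: t rule: induct_list012)
  case (2 x)
  then show ?case by (intro exI[of _ "[t]"]) auto
next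
  case (3 x y w)
  have "\<exists>ts. sorted_wrt (<) ts \<and> ts \<noteq> [] \<and> map (\<lambda>t. t mod r) ts = y # w \<and>
      hd ts = t + step r x y \<and> last ts = t + step r x y + travel r (y # w)"
    using 3 step_add_mod[of t r x y] by (intro 3(2)) auto
  then obtain ts where ts: "sorted_wrt (<) ts" "ts \<noteq> []" "map (\<lambda>t. t mod r) ts = y # w"
    "hd ts = t + step r x y" "last ts = t + step r x y + travel r (y # w)"
    by (elim exE conjE) (rule that)
  have "t < hd ts" using ts(4) 3 step_pos[of x r y] by auto
  then have "sorted_wrt (<) (t # ts)"
    using ts(1,2) by (cases ts) auto
  then show ?case using ts 3 by (intro exI[of _ "t # ts"]) auto
qed auto

section \<open>Subsequences and sparseness by positions\<close>

lemma subseq_map_uptD: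
  assumes "subseq v (map s [a..<b])"
  obtains ts where "v = map s ts" "sorted_wrt (<) ts" "set ts \<subseteq> {a..<b}"
proof -
  obtain N where N: "v = nths (map s [a..<b]) N" using assms by (auto simp: subseq_conv_nths)
  show thesis
  proof
    show "v = map s (nths [a..<b] N)" using N by (simp add: nths_map)
    show "sorted_wrt (<) (nths [a..<b] N)"
      by (simp add: strict_sorted_iff sorted_nths)
    show "set (nths [a..<b] N) \<subseteq> {a..<b}" using set_nths_subset[of "[a..<b]" N] by auto
  qed
qed

lemma subseq_set_subset: "subseq v w \<Longrightarrow> set v \<subseteq> set w"
  by (metis notin_set_nthsI subseq_conv_nths subsetI)

lemma subseq_uptI:
  assumes "sorted_wrt (<) ts" "set ts \<subseteq> {a..<b}"
  shows "subseq ts [a..<b]"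
proof -
  have "filter (\<lambda>t. t \<in> set ts) [a..<b] = ts"
    using assms
    by (intro sorted_distinct_set_unique)
      (auto simp: strict_sorted_iff intro: sorted_filter[of id, simplified])
  then show ?thesis by (metis subseq_filter_left)
qed

lemma upt_split: "a \<le> b \<Longrightarrow> b \<le> c \<Longrightarrow> [a..<c] = [a..<b] @ [b..<c]"
  by (metis le_add_diff_inverse upt_add_eq_append)

lemma subseq_map_upt_mono:
  "a' \<le> a \<Longrightarrow> b \<le> b' \<Longrightarrow> subseq (map s [a..<b]) (map s [a'..<b'])"
  by (intro subseq_map subseq_uptI) auto

lemma sparse_map_uptI:
  assumes "\<And>i j. i < j \<Longrightarrow> j < n \<Longrightarrow> j < i + r \<Longrightarrow> s i \<noteq> s j"
  shows "sparse r (map s [0..<n])"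
  unfolding sparse_def
proof (intro allI impI, elim conjE)
  fix w assume "sublist w (map s [0..<n])" and len: "length w \<le> r"
  then obtain p q where pq: "map s [0..<n] = p @ w @ q" by (auto simp: sublist_def)
  then have n: "n = length p + length w + length q"
    by (metis length_append length_map length_upt add.assoc diff_zero)
  have nth: "w ! i = s (length p + i)" if "i < length w" for i
  proof -
    have "w ! i = map s [0..<n] ! (length p + i)" using that by (simp add: pq nth_append)
    then show ?thesis using that n by simp
  qed
  have "w ! i \<noteq> w ! j" if "i < j" "j < length w" for i j
    using that assms[of "length p + i" "length p + j"] n len by (auto simp: nth)
  then show "distinct w" by (metis distinct_conv_nth nat_neq_iff)
qed

lemma sparseD:
  assumes "sparse r s" "i < j" "j < length s" "j < i + r"
  shows "s ! i \<noteq> s ! j"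
proof -
  define w where "w = take (Suc (j - i)) (drop i s)"
  have "sublist w s" by (metis w_def sublist_drop sublist_take sublist_order.order_trans)
  then have "distinct w" using assms by (auto simp: sparse_def w_def)
  then have "w ! 0 \<noteq> w ! (j - i)"
    using assms by (subst nth_eq_iff_index_eq) (auto simp: w_def)
  then show ?thesis using assms by (simp add: w_def)
qed

lemma sparse_sublist: "sparse r s \<Longrightarrow> sublist t s \<Longrightarrow> sparse r t"
  unfolding sparse_def using sublist_order.order_trans by blast

lemma avoids_subseq: "avoids s u \<Longrightarrow> subseq t s \<Longrightarrow> avoids t u"
  unfolding avoids_def using subseq_order.order_trans by blast

lemma not_avoidsI: "inj_on f (set u) \<Longrightarrow> subseq (map f u) s \<Longrightarrow> \<not> avoids s u"
  by (auto simp: avoids_def isomorphic_seq_def)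

lemma not_avoidsE:
  assumes "\<not> avoids s u"
  obtains f where "inj_on f (set u)" "subseq (map f u) s"
  using assms by (auto simp: avoids_def isomorphic_seq_def)

text \<open>
  The start \<open>p\<close> is arbitrary because the placement \<open>g\<close> can be rotated along the cycle without
  changing the distance travelled. The images of the first and the last letter are recorded so that
  copies can be prolonged at their ends.
\<close>

lemma copy_in_periodic:
  assumes "w \<noteq> []" "inj_on g (set w)" "g ` set w \<subseteq> {..<r}" "inj_on \<phi> {..<r}"
  obtains f where "inj_on f (set w)"
    "subseq (map f w) (map (\<lambda>t. \<phi> (t mod r)) [p..<p + Suc (travel r (map g w))])"
    "f (hd w) = \<phi> (p mod r)" "f (last w) = \<phi> ((p + travel r (map g w)) mod r)"
proof -
  define t0 where "t0 = g (hd w)"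
  have t0: "t0 < r" using assms(3) hd_in_set[OF assms(1)] by (auto simp: t0_def)
  obtain ts where ts: "sorted_wrt (<) ts" "ts \<noteq> []" "map (\<lambda>t. t mod r) ts = map g w"
    "hd ts = t0" "last ts = t0 + travel r (map g w)"
    using schedule_exists[of "map g w" r t0] assms(1,3) t0 by (auto simp: t0_def hd_map)
  define f where "f x = \<phi> ((g x + (r - t0) + p) mod r)" for x
  have range: "t0 \<le> t \<and> t \<le> last ts" if "t \<in> set ts" for t
  proof -
    have "hd ts \<le> t"
      using that ts(1,2) by (cases ts) auto
    moreover have "t \<le> last ts"
      using that ts(1,2) by (induction ts) (auto intro: less_imp_le)
    ultimately show ?thesis using ts(4) by simp
  qed
  have shift: "(t mod r + (r - t0) + p) mod r = (t - t0 + p) mod r" if "t0 \<le> t" for t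
  proof -
    have "(t mod r + (r - t0) + p) mod r = (t + ((r - t0) + p)) mod r"
      by (simp add: mod_add_left_eq add.assoc)
    also have "t + ((r - t0) + p) = (t - t0 + p) + r" using that t0 by simp
    finally show ?thesis by simp
  qed
  have "map f w = map (\<lambda>x. \<phi> ((x + (r - t0) + p) mod r)) (map g w)"
    by (simp add: f_def)
  also have "\<dots> = map (\<lambda>x. \<phi> ((x + (r - t0) + p) mod r)) (map (\<lambda>t. t mod r) ts)"
    by (simp only: ts(3))
  also have "\<dots> = map (\<lambda>t. \<phi> ((t - t0 + p) mod r)) ts"
    using range by (simp add: shift)
  finally have f_map: "map f w = map (\<lambda>t. \<phi> (t mod r)) (map (\<lambda>t. t - t0 + p) ts)" by simp
  have sorted: "sorted_wrt (<) (map (\<lambda>t. t - t0 + p) ts)"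
    using ts(1) range by (auto simp: sorted_wrt_map intro!: sorted_wrt_mono_rel[OF _ ts(1)] diff_less_mono)
  have "subseq (map f w) (map (\<lambda>t. \<phi> (t mod r)) [p..<p + Suc (travel r (map g w))])"
    unfolding f_map using range ts(5) by (intro subseq_map subseq_uptI sorted) fastforce
  moreover have "f (hd w) = \<phi> (p mod r)"
    using t0 by (simp add: f_def t0_def add.commute)
  moreover have "f (last w) = \<phi> ((p + travel r (map g w)) mod r)"
  proof -
    have "f (last w) = last (map f w)" using assms(1) by (simp add: last_map)
    then show ?thesis using ts(2,5) by (simp add: f_map last_map add.commute)
  qed
  moreover have "inj_on f (set w)"
  proof (rule inj_onI)
    fix x y assume xy: "x \<in> set w" "y \<in> set w" "f x = f y"
    then have "(g x + (r - t0) + p) mod r = (g y + (r - t0) + p) mod r"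
      using assms(4) t0 by (auto simp: f_def inj_on_def)
    then have "[g x + ((r - t0) + p) = g y + ((r - t0) + p)] (mod r)"
      by (simp add: cong_def add.assoc)
    then have "[g x = g y] (mod r)" by (simp add: cong_add_rcancel_nat)
    moreover have "g x < r" "g y < r" using assms(3) xy by auto
    ultimately have "g x = g y" by (simp add: cong_def)
    then show "x = y" using assms(2) xy by (auto simp: inj_on_def)
  qed
  ultimately show thesis using that by blast
qed

section \<open>From seeds to saturated sequences\<close>

text \<open>
  A longest sparse \<open>u\<close>-avoiding supersequence of the seed is saturated; it exists because such
  sequences over a finite alphabet have bounded length.
\<close>

lemma saturated_extension:
  fixes u :: "'a list" and A :: "'b set"
  assumes "finite A" "u \<noteq> []" "set s \<subseteq> A" "sparse (card (set u)) s" "avoids s u"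
  obtains z where "saturated A u z" "subseq s z"
proof -
  define P where "P z \<longleftrightarrow> set z \<subseteq> A \<and> sparse (card (set u)) z \<and> avoids z u \<and> subseq s z"
    for z :: "'b list"
  have P0: "P s" using assms(3-5) by (simp add: P_def)
  obtain N where N: "\<And>z. P z \<Longrightarrow> length z \<le> N"
    using sparse_avoids_length_bound[OF assms(1,2)] unfolding P_def by blast
  obtain z where z: "P z" "\<And>t. P t \<Longrightarrow> length t \<le> length z"
    using ex_has_greatest_nat[of P s length "Suc N"] P0 N by (auto simp: less_Suc_eq_le)
  have max: "\<not> P (p @ x # q)" if "z = p @ q" for p q x
    using z(2)[of "p @ x # q"] that by auto
  have sub: "subseq s (p @ x # q)" if "z = p @ q" for p q x
  proof -
    have "subseq (p @ q) (p @ x # q)" by (intro list_emb_append_mono) auto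
    then show ?thesis using z(1) that subseq_order.order_trans unfolding P_def by blast
  qed
  have "saturated A u z"
    unfolding saturated_def
    using z(1) max sub unfolding P_def by auto
  then show thesis using z(1) that by (auto simp: P_def)
qed

lemma Sat_le: "saturated {..<n} u z \<Longrightarrow> Sat n u \<le> length z"
  unfolding Sat_def by (rule cInf_lower) auto

text \<open>
  Only the size of the alphabet matters, not which letters it consists of: rename them to
  \<open>0, \<dots>, K - 1\<close>.
\<close>

lemma uniform_length_bound:
  fixes u :: "'a list"
  assumes "u \<noteq> []"
  obtains N where "\<And>(L :: 'b set) z. finite L \<Longrightarrow> card L \<le> K \<Longrightarrow> set z \<subseteq> L \<Longrightarrow>
    sparse (card (set u)) z \<Longrightarrow> avoids z u \<Longrightarrow> length z \<le> N"
proof -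
  obtain N where N: "\<And>z. set z \<subseteq> {..<K} \<Longrightarrow> sparse (card (set u)) z \<Longrightarrow> avoids z u \<Longrightarrow> length z \<le> N"
    using sparse_avoids_length_bound[of "{..<K}" u] assms by blast
  have "length z \<le> N"
    if L: "finite L" "card L \<le> K" "set z \<subseteq> L" "sparse (card (set u)) z" "avoids z u"
    for L :: "'b set" and z
  proof -
    obtain e where e: "inj_on e L" "e ` L \<subseteq> {..<K}"
      using card_le_inj[of L "{..<K}"] L(1,2) by auto
    have inj: "inj_on e (set z)" using e(1) L(3) inj_on_subset by blast
    have "map e z = map (\<lambda>i. e (z ! i)) [0..<length z]"
      by (rule nth_equalityI) auto
    moreover have "sparse (card (set u)) (map (\<lambda>i. e (z ! i)) [0..<length z])"
    proof (rule sparse_map_uptI)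
      fix i j assume ij: "i < j" "j < length z" "j < i + card (set u)"
      then show "e (z ! i) \<noteq> e (z ! j)"
        using sparseD[OF L(4), of i j] inj by (auto simp: inj_on_eq_iff)
    qed
    moreover have "avoids (map e z) u"
    proof (rule ccontr)
      assume "\<not> avoids (map e z) u"
      then obtain f where f: "inj_on f (set u)" "subseq (map f u) (map e z)" by (rule not_avoidsE)
      obtain v where v: "subseq v z" "map f u = map e v"
        using f(2) by (metis subseq_conv_nths nths_map)
      have "set v \<subseteq> set z" using v(1) by (rule subseq_set_subset)
      then have "map (the_inv_into (set z) e) (map e v) = v"
        using inj by (auto intro!: map_idI simp: the_inv_into_f_f subset_iff)
      then have "v = map (the_inv_into (set z) e \<circ> f) u" using v(2) by (metis map_map)
      moreover have "f ` set u \<subseteq> e ` set z"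
        using v(2) \<open>set v \<subseteq> set z\<close> by (metis image_mono list.set_map)
      then have "inj_on (the_inv_into (set z) e \<circ> f) (set u)"
        using f(1) inj by (meson comp_inj_on inj_on_subset inj_on_the_inv_into)
      ultimately show False using L(5) v(1) not_avoidsI by metis
    qed
    ultimately have "length (map e z) \<le> N" using e(2) L(3) by (intro N) force+
    then show ?thesis by simp
  qed
  then show thesis using that by blast
qed

text \<open>
  A saturated extension of the seed splits into one stretch for each block of the seed and one
  stretch after the last block. A letter \<open>x\<close> of the stretch for block \<open>k\<close> still comes after all
  earlier and before all later blocks; as the extension avoids \<open>u\<close>, only letters of \<open>L k\<close> qualify.
  The index \<open>k = M\<close> stands for the stretch at the end.
\<close>

lemma Sat_le_blocks:
  fixes u :: "'a list" and s c :: "nat \<Rightarrow> nat"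
  assumes u: "u \<noteq> []" and mono: "mono c" and c0: "c 0 = 0"
    and s: "s ` {..<c M} \<subseteq> {..<n}" "sparse (card (set u)) (map s [0..<c M])"
      "avoids (map s [0..<c M]) u"
    and N: "\<And>k z. k \<le> M \<Longrightarrow> set z \<subseteq> L k \<Longrightarrow> sparse (card (set u)) z \<Longrightarrow> avoids z u \<Longrightarrow> length z \<le> N"
    and ins: "\<And>k x. k \<le> M \<Longrightarrow> x < n \<Longrightarrow> x \<notin> L k \<Longrightarrow>
        \<not> avoids (map s [0..<c k] @ x # map s [c (Suc k)..<c M]) u"
  shows "Sat n u \<le> Suc M * N"
proof -
  have "set (map s [0..<c M]) \<subseteq> {..<n}" using s(1) by fastforce
  then obtain z where z: "saturated {..<n} u z" "subseq (map s [0..<c M]) z"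
    using saturated_extension[OF finite_lessThan u _ s(2,3)] by blast
  have zP: "set z \<subseteq> {..<n}" "sparse (card (set u)) z" "avoids z u"
    using z(1) by (auto simp: saturated_def)
  \<comment> \<open>The suffix \<open>y\<close> of the extension that begins with the stretch for block \<open>k\<close>.\<close>
  have "length y \<le> (Suc M - k) * N"
    if "z = x @ y" "subseq (map s [0..<c k]) x" "subseq (map s [c k..<c M]) y" "k \<le> M" for k x y
    using that
  proof (induction "M - k" arbitrary: k x y)
    case 0
    have "set y \<subseteq> L M"
    proof
      fix l assume l: "l \<in> set y"
      then have "subseq (map s [0..<c k] @ [l]) (x @ y)"
        using 0(3) by (intro list_emb_append_mono) (auto simp: subseq_singleton_left)
      then have "avoids (map s [0..<c k] @ [l]) u"
        using zP(3) 0(2) avoids_subseq by blast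
      moreover have "l < n" using zP(1) l 0(2) by auto
      moreover have "c M \<le> c (Suc M)" using mono by (simp add: monoD)
      ultimately show "l \<in> L M" using ins[of M l] 0(1,5) by auto
    qed
    moreover have "sparse (card (set u)) y" "avoids y u"
      using zP(2,3) 0(2) sparse_sublist avoids_subseq by (meson sublist_append_leftI sublist_imp_subseq)+
    ultimately show ?case using N[of M y] 0(1,5) by auto
  next
    case (Suc d)
    then have k: "k < M" by simp
    have le: "c k \<le> c (Suc k)" "c (Suc k) \<le> c M" using mono k by (auto intro: monoD)
    have upt: "[c k..<c M] = [c k..<c (Suc k)] @ [c (Suc k)..<c M]"
      "[0..<c (Suc k)] = [0..<c k] @ [c k..<c (Suc k)]"
      using upt_split[OF le] upt_split[OF le0 le(1)] by auto
    obtain y1 y2 where y: "y = y1 @ y2" "subseq (map s [c k..<c (Suc k)]) y1"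
      "subseq (map s [c (Suc k)..<c M]) y2"
      using Suc.prems(3) unfolding upt map_append by (metis list_emb_appendD)
    have "set y1 \<subseteq> L k"
    proof
      fix l assume l: "l \<in> set y1"
      then obtain p q where pq: "y1 = p @ l # q" by (metis split_list)
      have "subseq (map s [0..<c k] @ l # map s [c (Suc k)..<c M]) (x @ l # y2)"
        using Suc.prems(2) y(3) by (intro list_emb_append_mono) auto
      moreover have "subseq (x @ l # y2) z"
        unfolding Suc.prems(1) y(1) pq by (simp add: subseq_append' subseq_drop_many)
      ultimately have "avoids (map s [0..<c k] @ l # map s [c (Suc k)..<c M]) u"
        using zP(3) avoids_subseq subseq_order.order_trans by blast
      moreover have "l < n" using zP(1) l Suc.prems(1) y(1) by auto
      ultimately show "l \<in> L k" using ins[of k l] k by auto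
    qed
    moreover have "sublist y1 z" using Suc.prems(1) y(1) by (auto simp: sublist_appendI)
    then have "sparse (card (set u)) y1" "avoids y1 u"
      using zP(2,3) sparse_sublist avoids_subseq sublist_imp_subseq by blast+
    ultimately have "length y1 \<le> N" using N[of k y1] k by auto
    moreover have "length y2 \<le> (Suc M - Suc k) * N"
      using Suc.hyps(2) Suc.prems(1,2) y k upt(2)
      by (intro Suc.hyps(1)[of "Suc k" "x @ y1"]) (auto intro: list_emb_append_mono)
    moreover have "Suc M - k = Suc (Suc M - Suc k)" using k by simp
    ultimately show ?case using y(1) by simp
  qed
  from this[of "[]" z 0] z c0 have "length z \<le> Suc M * N" by simp
  then show ?thesis using Sat_le[OF z(1)] by linarith
qed

text \<open>
  The seed is a prefix, ending after \<open>M n\<close> blocks, of an infinite sequence \<open>s\<close> that does not depend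
  on \<open>n\<close>. The sets \<open>L n k\<close> may contain a bounded number of letters that are not controlled at all,
  such as those for which no block is left in the prefix.
\<close>

lemma Sat_linear_by_blocks:
  fixes u :: "'a list" and s c :: "nat \<Rightarrow> nat"
  assumes "u \<noteq> []" "mono c" "c 0 = 0"
    and "\<And>l. sparse (card (set u)) (map s [0..<l])" "\<And>k. avoids (map s [0..<c k]) u"
    and "\<And>n. nmin \<le> n \<Longrightarrow> M n \<le> n" "\<And>n. nmin \<le> n \<Longrightarrow> s ` {..<c (M n)} \<subseteq> {..<n}"
    and "\<And>n k. nmin \<le> n \<Longrightarrow> k \<le> M n \<Longrightarrow> finite (L n k) \<and> card (L n k) \<le> K"
    and "\<And>n k x. nmin \<le> n \<Longrightarrow> k \<le> M n \<Longrightarrow> x < n \<Longrightarrow> x \<notin> L n k \<Longrightarrow>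
        \<not> avoids (map s [0..<c k] @ x # map s [c (Suc k)..<c (M n)]) u"
  shows "(\<lambda>n. real (Sat n u)) \<in> O(\<lambda>n. real n)"
proof -
  obtain N where N: "\<And>(L :: nat set) z. finite L \<Longrightarrow> card L \<le> K \<Longrightarrow> set z \<subseteq> L \<Longrightarrow>
    sparse (card (set u)) z \<Longrightarrow> avoids z u \<Longrightarrow> length z \<le> N"
    by (rule uniform_length_bound[OF assms(1)]) (rule that; assumption)
  have "Sat n u \<le> 2 * N * n" if n: "n \<ge> max 1 nmin" for n
  proof -
    have nmin: "nmin \<le> n" using n by simp
    have "Sat n u \<le> Suc (M n) * N"
    proof (rule Sat_le_blocks[OF assms(1-3) assms(7)[OF nmin] assms(4,5)])
      show "length z \<le> N"
        if "k \<le> M n" "set z \<subseteq> L n k" "sparse (card (set u)) z" "avoids z u" for k z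
        using N[of "L n k" z] assms(8)[OF nmin, of k] that by auto
    qed (rule assms(9)[OF nmin])
    also have "\<dots> \<le> Suc n * N" using assms(6)[OF nmin] by (intro mult_le_mono1) simp
    also have "\<dots> \<le> 2 * N * n" using n by (cases n) auto
    finally show ?thesis .
  qed
  then have "real (Sat n u) \<le> 2 * real N * real n" if "n \<ge> max 1 nmin" for n
    using that by (metis of_nat_le_iff of_nat_mult of_nat_numeral)
  then show ?thesis
    by (intro bigoI[of _ "2 * real N"] eventually_sequentiallyI[of "max 1 nmin"]) auto
qed

section \<open>Doubled ends\<close>

lemma step_self: "step r x x = r"
  by (simp add: step_def)

text \<open>
  The periodic word is one letter too short for \<open>u\<close>. After the inserted letter has played the first
  \<open>a\<close>, the rest \<open>a # v\<close> needs \<open>r\<close> letters less, so it may start at the first occurrence of that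
  letter in the word, at position \<open>j < r\<close>.
\<close>

lemma doubled_start_copy:
  assumes "inj_on g (set u)" "g ` set u \<subseteq> {..<r}" "inj_on \<phi> {..<r}" "j < r" "u = a # a # v"
  shows "\<not> avoids (\<phi> j # map (\<lambda>t. \<phi> (t mod r)) [0..<travel r (map g u)]) u"
proof -
  have set: "set (a # v) = set u" using assms(5) by auto
  obtain f where f: "inj_on f (set u)"
    "subseq (map f (a # v)) (map (\<lambda>t. \<phi> (t mod r)) [j..<j + Suc (travel r (map g (a # v)))])"
    "f a = \<phi> j"
  proof (rule copy_in_periodic[of "a # v" g r \<phi> j])
  qed (use assms set in auto)
  have "travel r (map g u) = r + travel r (map g (a # v))"
    using assms(5) by (simp add: step_self)
  then have "subseq (map f (a # v)) (map (\<lambda>t. \<phi> (t mod r)) [0..<travel r (map g u)])"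
    using f(2) assms(4) by (elim subseq_order.order_trans) (intro subseq_map_upt_mono, auto)
  then have "subseq (map f u) (\<phi> j # map (\<lambda>t. \<phi> (t mod r)) [0..<travel r (map g u)])"
    using f(3) assms(5) by simp
  then show ?thesis using f(1) not_avoidsI by blast
qed

lemma doubled_end_copy:
  assumes "inj_on g (set u)" "g ` set u \<subseteq> {..<r}" "inj_on \<phi> {..<r}" "j < r" "u = w @ [b, b]"
  shows "\<not> avoids (map (\<lambda>t. \<phi> (t mod r)) [0..<travel r (map g u)] @ [\<phi> j]) u"
proof -
  have set: "set (w @ [b]) = set u" using assms(5) by auto
  define K T where "K = travel r (map g u)" and "T = travel r (map g (w @ [b]))"
  have KT: "K = T + r"
    using travel_append[of "map g (w @ [b])" "[g b]" r] assms(5)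
    by (simp add: K_def T_def step_self)
  \<comment> \<open>\<open>E\<close> is the first time from \<open>K\<close> on with residue \<open>j\<close>, so \<open>E - r\<close> is the last one before \<open>K\<close>.\<close>
  define E where "E = K - 1 + step r ((K - 1) mod r) j"
  have E: "E mod r = j" "K \<le> E" "E < K + r"
    using step_add_mod[of "K - 1" r "(K - 1) mod r" j] step_pos[of "(K - 1) mod r" r j] assms(4) KT
      step_le[of "(K - 1) mod r" r j] by (simp_all add: E_def)
  define e where "e = E - r"
  have e: "e mod r = j" "T \<le> e" "e < K"
    using E KT by (auto simp: e_def le_mod_geq)
  obtain f where f: "inj_on f (set u)"
    "subseq (map f (w @ [b])) (map (\<lambda>t. \<phi> (t mod r)) [e - T..<e - T + Suc T])"
    "f b = \<phi> j"
  proof (rule copy_in_periodic[of "w @ [b]" g r \<phi> "e - T"])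
  qed (use assms(1-4) e(1,2) in \<open>simp_all add: set T_def[symmetric] del: map_append set_append upt_Suc\<close>)
  have "subseq (map f (w @ [b])) (map (\<lambda>t. \<phi> (t mod r)) [0..<K])"
    using f(2) e by (elim subseq_order.order_trans) (intro subseq_map_upt_mono, auto)
  then have "subseq (map f (w @ [b]) @ [\<phi> j]) (map (\<lambda>t. \<phi> (t mod r)) [0..<K] @ [\<phi> j])"
    by (intro list_emb_append_mono) auto
  then have "subseq (map f u) (map (\<lambda>t. \<phi> (t mod r)) [0..<K] @ [\<phi> j])"
    using f(3) assms(5) by simp
  then show ?thesis using f(1) not_avoidsI unfolding K_def by blast
qed

text \<open>
  The letters \<open>x\<close> with \<open>x div r = k\<close> belong to block \<open>k\<close> only, so a copy of \<open>u\<close> that reached over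
  two blocks would decompose \<open>u\<close>.
\<close>

lemma indecomposable_copy_in_block:
  assumes "\<not> decomposable u" "inj_on f (set u)" "u \<noteq> []"
    "\<And>t. s t div r = t div K" "subseq (map f u) (map s [0..<M * K])"
  obtains k where "k < M" "subseq (map f u) (map s [k * K..<Suc k * K])"
proof -
  have "\<exists>k<M. subseq (map f u) (map s [k * K..<Suc k * K])"
    using assms(5)
  proof (induction M)
    case 0
    then show ?case using assms(3) by simp
  next
    case (Suc M)
    have "[0..<Suc M * K] = [0..<M * K] @ [M * K..<Suc M * K]" by (intro upt_split) auto
    then have "subseq (map f u) (map s [0..<M * K] @ map s [M * K..<Suc M * K])"
      using Suc.prems by (metis map_append)
    then obtain v1 v2 where v: "map f u = v1 @ v2" "subseq v1 (map s [0..<M * K])"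
      "subseq v2 (map s [M * K..<Suc M * K])" by (metis subseq_append_iff)
    then obtain u1 u2 where u: "u = u1 @ u2" "v1 = map f u1" "v2 = map f u2"
      by (metis map_eq_append_conv)
    have "x div r < M" if "x \<in> set v1" for x
    proof -
      obtain t where "t < M * K" "x = s t"
        using subsetD[OF subseq_set_subset[OF v(2)] \<open>x \<in> set v1\<close>] by auto
      then show ?thesis using assms(4) by (simp add: less_mult_imp_div_less)
    qed
    moreover have "M \<le> x div r" if "x \<in> set v2" for x
    proof -
      obtain t where t: "M * K \<le> t" "t < Suc M * K" "x = s t"
        using subsetD[OF subseq_set_subset[OF v(3)] \<open>x \<in> set v2\<close>] by auto
      then have "K > 0" by (intro gr0I) auto
      then have "M \<le> t div K" using t(1) by (simp add: less_eq_div_iff_mult_less_eq)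
      then show ?thesis using t(3) assms(4) by simp
    qed
    ultimately have "set v1 \<inter> set v2 = {}" by fastforce
    then have "set u1 \<inter> set u2 = {}" using u by auto
    then have "u1 = [] \<or> u2 = []" using assms(1) u(1) unfolding decomposable_def by blast
    then show ?case
    proof
      assume "u1 = []"
      then show ?thesis using v u by auto
    next
      assume "u2 = []"
      then have "subseq (map f u) (map s [0..<M * K])" using v u by auto
      then show ?thesis using Suc.IH less_SucI by blast
    qed
  qed
  then show thesis using that by blast
qed

lemma minimal_labelling:
  obtains g :: "'a \<Rightarrow> nat" where "inj_on g (set u)" "g ` set u \<subseteq> {..<card (set u)}"
    "\<And>h. inj_on h (set u) \<Longrightarrow> h ` set u \<subseteq> {..<card (set u)} \<Longrightarrow>
       travel (card (set u)) (map g u) \<le> travel (card (set u)) (map h u)"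
proof -
  define P where "P g \<longleftrightarrow> inj_on g (set u) \<and> g ` set u \<subseteq> {..<card (set u)}" for g :: "'a \<Rightarrow> nat"
  obtain g0 where "bij_betw g0 (set u) {0..<card (set u)}"
    using ex_bij_betw_finite_nat[of "set u"] by auto
  then have "P g0" unfolding P_def bij_betw_def by auto
  then obtain g where g: "P g" "\<And>h. P h \<Longrightarrow>
      travel (card (set u)) (map g u) \<le> travel (card (set u)) (map h u)"
    using ex_has_least_nat[of P g0 "\<lambda>h. travel (card (set u)) (map h u)"] by auto
  show thesis by (rule that[of g]) (use g in \<open>auto simp: P_def\<close>)
qed

lemma doubled_ends_linear:
  fixes u :: "'a list"
  assumes "doubled_ends u" "\<not> decomposable u"
  shows "(\<lambda>n. real (Sat n u)) \<in> O(\<lambda>n. real n)"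
proof -
  define r where "r = card (set u)"
  obtain a v where uav: "u = a # a # v" using assms(1) unfolding doubled_ends_def by auto
  obtain b w where uwb: "u = w @ [b, b]" using assms(1) unfolding doubled_ends_def by auto
  have u: "u \<noteq> []" and r: "r > 0" using uav by (auto simp: r_def card_gt_0_iff)
  obtain g where g: "inj_on g (set u)" "g ` set u \<subseteq> {..<r}"
    and least: "\<And>h. inj_on h (set u) \<Longrightarrow> h ` set u \<subseteq> {..<r} \<Longrightarrow>
       travel r (map g u) \<le> travel r (map h u)"
    by (rule minimal_labelling[of u, folded r_def]) (rule that; assumption)
  define K where "K = travel r (map g u)"
  have K: "K > 0" using uav r by (simp add: K_def step_self)
  \<comment> \<open>Block \<open>k\<close> is the periodic word of length \<open>K\<close> on the letters \<open>k * r, \<dots>, k * r + r - 1\<close>.\<close>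
  define s where "s t = t div K * r + t mod K mod r" for t
  have s_div: "s t div r = t div K" and s_mod: "s t mod r = t mod K mod r" for t
    using r by (simp_all add: s_def)
  have block: "map s [k * K..<Suc k * K] = map (\<lambda>t. k * r + t mod r) [0..<K]" for k
    by (rule nth_equalityI) (simp_all add: s_def)
  have neq: "s i \<noteq> s j" if "i < j" "j < i + r" for i j
  proof
    assume "s i = s j"
    then have eq: "i div K = j div K" "i mod K mod r = j mod K mod r"
      using s_div s_mod by metis+
    have "i = i div K * K + i mod K" "j = i div K * K + j mod K"
      using eq(1) by (metis div_mult_mod_eq)+
    then have "j mod K - i mod K = j - i" "i mod K \<le> j mod K" using that(1) by linarith+
    then have "r dvd j - i" using eq(2) mod_eq_dvd_iff_nat by metis
    then show False using that by (auto dest: dvd_imp_le)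
  qed
  have avoid: "avoids (map s [0..<M * K]) u" for M
  proof (rule ccontr)
    assume "\<not> ?thesis"
    then obtain f where f: "inj_on f (set u)" "subseq (map f u) (map s [0..<M * K])"
      by (rule not_avoidsE)
    obtain k where k: "subseq (map f u) (map s [k * K..<Suc k * K])"
      using indecomposable_copy_in_block[OF assms(2) f(1) u s_div f(2)] by blast
    then obtain ts where ts: "map f u = map (\<lambda>t. k * r + t mod r) ts" "sorted_wrt (<) ts"
      "set ts \<subseteq> {0..<K}" unfolding block by (rule subseq_map_uptD)
    have "map (\<lambda>x. x - k * r) (map f u) = map (\<lambda>x. x - k * r) (map (\<lambda>t. k * r + t mod r) ts)"
      using ts(1) by simp
    then have h: "map (\<lambda>x. f x - k * r) u = map (\<lambda>t. t mod r) ts" by (simp add: comp_def)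
    have range: "k * r \<le> f x \<and> f x < k * r + r" if "x \<in> set u" for x
    proof -
      have "f x \<in> set (map (\<lambda>t. k * r + t mod r) ts)" using that ts(1) by (metis image_eqI list.set_map)
      then show ?thesis using r by auto
    qed
    have "inj_on (\<lambda>x. f x - k * r) (set u)"
      using f(1) range by (auto simp: inj_on_def) (metis eq_diff_iff)
    moreover have "(\<lambda>x. f x - k * r) ` set u \<subseteq> {..<r}" using range by fastforce
    ultimately have "K \<le> travel r (map (\<lambda>t. t mod r) ts)" using least h unfolding K_def by metis
    moreover have "ts \<noteq> []" using ts(1) u by auto
    then have "travel r (map (\<lambda>t. t mod r) ts) \<le> last ts" "last ts < K"
      using travel_le_span[OF ts(2) _ r] ts(3) last_in_set[of ts] by (auto simp: subset_iff)
    ultimately show False by linarith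
  qed
  have inj: "inj_on ((+) (k * r)) {..<r}" for k by simp
  have front: "\<not> avoids (x # map s [x div r * K..<Suc (x div r) * K]) u" for x
    using doubled_start_copy[OF g inj _ uav, of "x mod r" "x div r"] r
    unfolding block K_def[symmetric] by simp
  have rear: "\<not> avoids (map s [x div r * K..<Suc (x div r) * K] @ [x]) u" for x
    using doubled_end_copy[OF g inj _ uwb, of "x mod r" "x div r"] r
    unfolding block K_def[symmetric] by simp
  define M where "M n = n div r" for n
  \<comment> \<open>Besides the letters of block \<open>k\<close>, the fewer than \<open>r\<close> letters that fill no block are left free.\<close>
  define L where "L n k = {k * r..<Suc k * r} \<union> {M n * r..<n}" for n k
  have Mn: "M n * r \<le> n" "n < Suc (M n) * r" for n
    using r by (simp_all add: M_def dividend_less_div_times)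
  show ?thesis
  proof (rule Sat_linear_by_blocks[where s = s and c = "\<lambda>k. k * K" and L = L and M = M and nmin = 0])
    show "mono (\<lambda>k. k * K)" by (intro monoI) simp
    show "sparse (card (set u)) (map s [0..<l])" for l
      using neq unfolding r_def by (intro sparse_map_uptI) auto
    show "s ` {..<M n * K} \<subseteq> {..<n}" for n
    proof safe
      fix t assume "t < M n * K"
      then have "s t div r < M n" by (simp add: s_div less_mult_imp_div_less)
      then have "s t < M n * r" using r by (simp add: div_less_iff_less_mult)
      then show "s t < n" using Mn(1)[of n] by simp
    qed
    show "finite (L n k) \<and> card (L n k) \<le> 2 * r" for n k
      using card_Un_le[of "{k * r..<Suc k * r}" "{M n * r..<n}"] Mn[of n] by (simp add: L_def)
    fix n k x assume kx: "k \<le> M n" "x < n" "x \<notin> L n k"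
    define q where "q = x div r"
    have q: "q * r \<le> x" "x < Suc q * r" "q < M n"
      using r kx by (auto simp: q_def L_def dividend_less_div_times div_less_iff_less_mult)
    have "q \<noteq> k" using kx(3) q by (auto simp: L_def)
    then consider "Suc k \<le> q" | "Suc q \<le> k" by linarith
    then show "\<not> avoids (map s [0..<k * K] @ x # map s [Suc k * K..<M n * K]) u"
    proof cases
      case 1
      have "subseq (x # map s [q * K..<Suc q * K]) (x # map s [Suc k * K..<M n * K])"
        using 1 q(3) mult_le_mono1[of "Suc k" q K] mult_le_mono1[of "Suc q" "M n" K]
        by (simp add: subseq_map_upt_mono del: mult_Suc)
      then have "\<not> avoids (x # map s [Suc k * K..<M n * K]) u"
        using front[of x] avoids_subseq unfolding q_def[symmetric] by blast
      then show ?thesis using avoids_subseq subseq_order.order_refl list_emb_append2 by blast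
    next
      case 2
      have "subseq (map s [q * K..<Suc q * K] @ [x])
          (map s [0..<k * K] @ x # map s [Suc k * K..<M n * K])"
        using 2 mult_le_mono1[of "Suc q" k K]
        by (intro list_emb_append_mono subseq_map_upt_mono) (auto simp del: mult_Suc)
      then show ?thesis using rear[of x] avoids_subseq unfolding q_def[symmetric] by blast
    qed
  qed (use u avoid in \<open>auto simp: M_def\<close>)
qed

section \<open>Cyclic triples\<close>

text \<open>
  Every term repeats the one three places before, except that at the multiples of \<open>m\<close> a new letter
  replaces it; the replaced letter never comes back. For example \<open>renewal 4\<close> begins
  \<open>0 1 2 0 3 2 0 3 4 0 3 4 5 3 4 5 6\<close>.
  With \<open>m + 2\<close> the distance that \<open>u\<close> travels, the three letters in use between two replacements,
  including the two terms before, form a periodic word of length \<open>m + 2\<close>, one letter too short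
  for \<open>u\<close>.
\<close>

fun renewal :: "nat \<Rightarrow> nat \<Rightarrow> nat" where
  "renewal m i = (if i < 3 then i else if m dvd i then i div m + 2 else renewal m (i - 3))"

declare renewal.simps[simp del]

lemma renewal_start: "i < 3 \<Longrightarrow> renewal m i = i"
  by (simp add: renewal.simps)

lemma renewal_fresh: "3 \<le> i \<Longrightarrow> m dvd i \<Longrightarrow> renewal m i = i div m + 2"
  by (simp add: renewal.simps)

lemma renewal_old: "3 \<le> i \<Longrightarrow> \<not> m dvd i \<Longrightarrow> renewal m i = renewal m (i - 3)"
  by (subst renewal.simps) simp

lemma renewal_le: "renewal m i \<le> i div m + 2"
proof (induction m i rule: renewal.induct)
  case (1 m i)
  have "(i - 3) div m \<le> i div m" by (intro div_le_mono) simp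
  then show ?case using 1 by (subst renewal.simps) auto
qed

lemma renewal_new:
  assumes "m > 0" "i < j" "3 \<le> j" "m dvd j"
  shows "renewal m i < renewal m j"
proof -
  have "i div m < j div m"
    using assms by (metis dvd_mult_div_cancel less_mult_imp_div_less mult.commute)
  then show ?thesis using renewal_le[of m i] renewal_fresh[of j m] assms by simp
qed

text \<open>
  A new letter inherits the residue modulo 3 of the times at which the replaced letter occurred, so
  each letter has one residue, which serves as its place on the cycle.
\<close>

lemma renewal_mod_eq_ordered:
  assumes "m > 0" "i \<le> j" "renewal m i = renewal m j"
  shows "i mod 3 = j mod 3"
  using assms(2,3)
proof (induction j arbitrary: i rule: less_induct)
  case (less j)
  show ?case
  proof (cases "i = j")
    case False
    then have ij: "i < j" using less.prems by simp
    show ?thesis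
    proof (cases "j < 3")
      case True
      then show ?thesis using ij less.prems by (simp add: renewal_start)
    next
      case False
      then have "\<not> m dvd j" using renewal_new[OF assms(1) ij] less.prems by auto
      then have eq: "renewal m i = renewal m (j - 3)"
        using less.prems False by (simp add: renewal_old)
      have "i mod 3 = (j - 3) mod 3"
      proof (cases "i \<le> j - 3")
        case True
        then show ?thesis using less.IH[of "j - 3" i] eq False by simp
      next
        case False
        then show ?thesis using less.IH[of i "j - 3"] eq ij by simp
      qed
      then show ?thesis using False by (simp add: le_mod_geq)
    qed
  qed simp
qed

lemma renewal_mod_eq:
  "m > 0 \<Longrightarrow> renewal m i = renewal m j \<Longrightarrow> i mod 3 = j mod 3"
  by (metis nat_le_linear renewal_mod_eq_ordered)

lemma mod3_gap:
  fixes t j :: nat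
  assumes "t < j" "t mod 3 = j mod 3"
  shows "t + 3 \<le> j"
proof -
  have "3 dvd j - t" using assms mod_eq_dvd_iff_nat[of t j 3] by simp
  then show ?thesis using assms(1) by (auto dest: dvd_imp_le)
qed

lemma renewal_distinct:
  assumes "m > 0" "i < j" "j < i + 3"
  shows "renewal m i \<noteq> renewal m j"
proof
  assume "renewal m i = renewal m j"
  then have "i mod 3 = j mod 3" using assms(1) by (rule_tac renewal_mod_eq)
  then show False using mod3_gap[of i j] assms(2,3) by simp
qed

lemma renewal_between:
  assumes "m > 0" "renewal m i = renewal m j" "i \<le> t" "t \<le> j" "t mod 3 = i mod 3"
  shows "renewal m t = renewal m i"
  using assms(2-5)
proof (induction j rule: less_induct)
  case (less j)
  show ?case
  proof (cases "t = j")
    case False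
    have "j mod 3 = i mod 3" using renewal_mod_eq[OF assms(1) less.prems(1)] by simp
    then have "t + 3 \<le> j" using less.prems(3,4) False by (intro mod3_gap) auto
    then have j: "t \<le> j - 3" "3 \<le> j" by simp_all
    then have "i < j" using less.prems(2) by linarith
    then have "\<not> m dvd j" using renewal_new[OF assms(1) \<open>i < j\<close> j(2)] less.prems(1) by auto
    then have "renewal m i = renewal m (j - 3)" using renewal_old[OF j(2)] less.prems(1) by simp
    then show ?thesis using less.IH[of "j - 3"] j less.prems by simp
  qed (use less.prems in simp)
qed

text \<open>
  Between two occurrences of a letter, all times of the same residue modulo 3 are occurrences too, and
  every window of three terms has such a time.
\<close>

lemma renewal_in_window:
  assumes "m > 0" "renewal m e = renewal m e'" "e \<le> t + 2" "t \<le> e'"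
  shows "\<exists>i\<in>{t, t + 1, t + 2}. renewal m i = renewal m e \<and> i mod 3 = e mod 3"
proof -
  have mod: "e mod 3 = e' mod 3" using renewal_mod_eq[OF assms(1,2)] .
  obtain i where i: "i \<in> {t, t + 1, t + 2}" "i mod 3 = e mod 3"
  proof -
    have "(t + (e + 2 * t) mod 3) mod 3 = (e + 3 * t) mod 3" by (simp add: mod_simps)
    moreover have "(e + 2 * t) mod 3 < 3" by simp
    ultimately show ?thesis by (intro that[of "t + (e + 2 * t) mod 3"]) auto
  qed
  have "e \<le> i" using mod3_gap[of i e] i assms(3) by fastforce
  moreover have "i \<le> e'" using mod3_gap[of e' i] i mod assms(4) by fastforce
  ultimately
  show ?thesis using renewal_between[OF assms(1,2), of i] i by auto
qed

text \<open>
  Three letters that have all been born by time \<open>i\<close> and are all still needed at time \<open>j\<close> fill every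
  window of three terms that meets the interval from \<open>i\<close> to \<open>j\<close>. So no replacement takes place at
  the times \<open>i + 1, \<dots>, j + 2\<close>, and these are fewer than \<open>m\<close>.
\<close>

lemma renewal_common_span:
  assumes "m > 0" "card \<Lambda> = 3" "i \<le> j"
    and before: "\<And>x. x \<in> \<Lambda> \<Longrightarrow> \<exists>e\<le>i. renewal m e = x"
    and after: "\<And>x. x \<in> \<Lambda> \<Longrightarrow> \<exists>e\<ge>j. renewal m e = x"
  shows "j + 3 \<le> i + m" "\<Lambda> \<subseteq> renewal m ` {i - 2, i - 1, i}" "2 \<le> i"
proof -
  have window: "\<Lambda> = renewal m ` {t, t + 1, t + 2}" if "i \<le> t + 2" "t \<le> j" for t
  proof (rule card_seteq)
    show "\<Lambda> \<subseteq> renewal m ` {t, t + 1, t + 2}"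
    proof
      fix x assume "x \<in> \<Lambda>"
      then obtain e e' where "e \<le> i" "renewal m e = x" "e' \<ge> j" "renewal m e' = x"
        using before after by meson
      then show "x \<in> renewal m ` {t, t + 1, t + 2}"
        using renewal_in_window[OF assms(1), of e e' t] that by fastforce
    qed
    have "card (renewal m ` {t, t + 1, t + 2}) \<le> card {t, t + 1, t + 2}"
      by (intro card_image_le) simp
    also have "\<dots> = 3" by simp
    finally show "card (renewal m ` {t, t + 1, t + 2}) \<le> card \<Lambda>" using assms(2) by simp
  qed simp
  show i: "2 \<le> i"
  proof (rule ccontr)
    assume "\<not> 2 \<le> i"
    have "\<Lambda> \<subseteq> renewal m ` {..i}" using before by (auto simp: image_iff)
    then have "card \<Lambda> \<le> card {..i}" by (meson card_image_le card_mono finite_atMost finite_imageI le_trans)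
    then show False using assms(2) \<open>\<not> 2 \<le> i\<close> by simp
  qed
  have "i - 2 + 1 = i - 1" "i - 2 + 2 = i" using i by simp_all
  then show "\<Lambda> \<subseteq> renewal m ` {i - 2, i - 1, i}" using window[of "i - 2"] assms(3) i by simp
  have not_fresh: "\<not> m dvd t" if "i < t" "t \<le> j + 2" for t
  proof
    assume "m dvd t"
    have t: "t - 3 + 1 < t" "t - 3 + 2 < t" "t - 3 < t" "3 \<le> t" using that i by simp_all
    have "t - 2 + 2 = t" using t by linarith
    then have "renewal m t \<in> renewal m ` {t - 2, t - 2 + 1, t - 2 + 2}"
      by (intro image_eqI[of _ _ "t - 2 + 2"]) simp_all
    also have "\<dots> = \<Lambda>" using window[of "t - 2"] that by simp
    also have "\<dots> = renewal m ` {t - 3, t - 3 + 1, t - 3 + 2}" using window[of "t - 3"] that by simp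
    finally have "\<exists>e\<in>{t - 3, t - 3 + 1, t - 3 + 2}. renewal m t = renewal m e" by blast
    then obtain e where "e < t" "renewal m t = renewal m e" using t by blast
    then show False using renewal_new[OF assms(1) _ t(4) \<open>m dvd t\<close>, of e] by simp
  qed
  show "j + 3 \<le> i + m"
  proof (rule ccontr)
    assume *: "\<not> ?thesis"
    define t where "t = (i div m + 1) * m"
    have "i mod m < m" using assms(1) by simp
    moreover have "i div m * m + i mod m = i" by simp
    moreover have "t = i div m * m + m" by (simp add: t_def)
    ultimately have "i < t" "t \<le> i + m" by linarith+
    moreover have "m dvd t" by (simp add: t_def)
    ultimately show False using not_fresh[of t] * by simp
  qed
qed

lemma renewal_periodic:
  assumes "m > 0" "3 \<le> k * m" "t < m + 2"
  shows "renewal m (k * m - 2 + t) = renewal m (k * m - 2 + t mod 3)"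
  using assms(3)
proof (induction t rule: less_induct)
  case (less t)
  show ?case
  proof (cases "t < 3")
    case False
    have "\<not> m dvd k * m - 2 + t"
    proof
      assume "m dvd k * m - 2 + t"
      moreover have "k * m - 2 + t = k * m + (t - 2)" using False assms(2) by simp
      ultimately have "m dvd t - 2" by (simp add: dvd_add_right_iff)
      then show False using False less.prems by (auto dest: dvd_imp_le)
    qed
    then have "renewal m (k * m - 2 + t) = renewal m (k * m - 2 + (t - 3))"
      using renewal_old[of "k * m - 2 + t" m] False assms(2) by simp
    then show ?thesis using less.IH[of "t - 3"] less.prems False by (simp add: le_mod_geq)
  qed simp
qed

text \<open>
  The letter \<open>k + 2\<close> is born at time \<open>k * m\<close> and recurs every three steps. At the latest it is
  replaced at time \<open>(k + 3) * m\<close>, which is a multiple of \<open>m\<close> with the same residue modulo 3.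
\<close>

lemma renewal_last_occurrence:
  assumes "m > 0" "3 \<le> k * m"
  obtains k' where "k < k'" "k' \<le> k + 3" "renewal m (k' * m - 3) = k + 2"
proof -
  have birth: "renewal m (k * m) = k + 2" using renewal_fresh[of "k * m" m] assms by simp
  have "(k * m + 3 * m) div m = k + 3" using assms(1) by (simp flip: add_mult_distrib)
  then have "renewal m (k * m + 3 * m) = k + 5"
    using renewal_fresh[of "k * m + 3 * m" m] assms by simp
  then have ex: "renewal m (k * m + 3 * m) \<noteq> k + 2" by simp
  define e where "e = (LEAST e. renewal m (k * m + 3 * e) \<noteq> k + 2)"
  have e: "renewal m (k * m + 3 * e) \<noteq> k + 2" "e \<le> m"
    unfolding e_def by (rule LeastI[of _ m], rule ex) (rule Least_le, rule ex)
  have e0: "e > 0" using e(1) birth by (intro gr0I) auto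
  have prev: "renewal m (k * m + 3 * (e - 1)) = k + 2"
    using not_less_Least[of "e - 1" "\<lambda>e. renewal m (k * m + 3 * e) \<noteq> k + 2"] e0
    unfolding e_def[symmetric] by simp
  have shift: "k * m + 3 * e - 3 = k * m + 3 * (e - 1)" using e0 by simp
  have "m dvd k * m + 3 * e"
    using renewal_old[of "k * m + 3 * e" m] prev e(1) assms(2) shift by auto
  then obtain k' where k': "k * m + 3 * e = k' * m" by (metis dvdE mult.commute)
  show thesis
  proof
    have "k * m < k' * m" using k' e0 by linarith
    then show "k < k'" by simp
    have "k' * m \<le> (k + 3) * m" using e(2) by (simp add: add_mult_distrib flip: k')
    then show "k' \<le> k + 3" using assms(1) by simp
    show "renewal m (k' * m - 3) = k + 2" using prev shift k' by simp
  qed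
qed

text \<open>
  The two placements, up to rotation, of the letters \<open>a, b, c\<close> on a cycle of length 3: the steps
  counted by \<open>f0\<close> have length 1 and those counted by \<open>f1\<close> length 2 in the first, and conversely in
  the second.
\<close>

definition forward :: "'a \<Rightarrow> 'a \<Rightarrow> 'a \<Rightarrow> nat" where
  "forward a b x = (if x = a then 0 else if x = b then 1 else 2)"

definition backward :: "'a \<Rightarrow> 'a \<Rightarrow> 'a \<Rightarrow> nat" where
  "backward a b x = (if x = a then 0 else if x = b then 2 else 1)"

lemma travel_map_cong:
  assumes "\<And>x y. x \<in> set u \<Longrightarrow> y \<in> set u \<Longrightarrow> step r (g x) (g y) = step r (h x) (h y)"
  shows "travel r (map g u) = travel r (map h u)"
  unfolding travel_conv_sum using assms by (intro sum.cong) auto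

lemma three_labellings:
  assumes "distinct [a, b, c]" "inj_on h {a, b, c}" "h ` {a, b, c} \<subseteq> {..<3}"
  shows "(\<forall>x\<in>{a, b, c}. \<forall>y\<in>{a, b, c}. step 3 (h x) (h y) = step 3 (forward a b x) (forward a b y)) \<or>
    (\<forall>x\<in>{a, b, c}. \<forall>y\<in>{a, b, c}. step 3 (h x) (h y) = step 3 (backward a b x) (backward a b y))"
proof -
  have less: "h a < 3" "h b < 3" "h c < 3" and neq: "h a \<noteq> h b" "h b \<noteq> h c" "h a \<noteq> h c"
    using assms by (auto simp: inj_on_def)
  have "t = 0 \<or> t = 1 \<or> t = 2" if "t < 3" for t :: nat using that by linarith
  then have "h a = 0 \<or> h a = 1 \<or> h a = 2" "h b = 0 \<or> h b = 1 \<or> h b = 2"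
    "h c = 0 \<or> h c = 1 \<or> h c = 2" using less by blast+
  then have "(h a, h b, h c) \<in> {(0, 1, 2), (1, 2, 0), (2, 0, 1), (0, 2, 1), (2, 1, 0), (1, 0, 2)}"
    using neq by (elim disjE) simp_all
  then show ?thesis using assms(1)
    by (simp only: insert_iff empty_iff prod.inject simp_thms)
      (elim disjE conjE; auto simp: step_def forward_def backward_def)
qed

lemma f_diff_eq_travel_diff:
  assumes "distinct [a, b, c]" "u = [a, b, c] @ v" "set u = {a, b, c}"
  shows "travel 3 (map (backward a b) u) + f1 u = travel 3 (map (forward a b) u) + f0 u"
proof -
  define F0 F1 where "F0 = {(a, b), (b, c), (c, a)}" and "F1 = {(a, c), (b, a), (c, b)}"
  have count: "card {k. Suc k < length u \<and> (u ! k, u ! Suc k) \<in> F} =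
      (\<Sum>k<length u - 1. of_bool ((u ! k, u ! Suc k) \<in> F))" for F
  proof -
    have "{k. Suc k < length u \<and> (u ! k, u ! Suc k) \<in> F} =
        {..<length u - 1} \<inter> {k. (u ! k, u ! Suc k) \<in> F}" by auto
    then show ?thesis by (simp add: sum.If_cases of_bool_def)
  qed
  have f: "f0 u = (\<Sum>k<length u - 1. of_bool ((u ! k, u ! Suc k) \<in> F0))"
    "f1 u = (\<Sum>k<length u - 1. of_bool ((u ! k, u ! Suc k) \<in> F1))"
    using assms(2) unfolding count[symmetric] by (simp_all add: f0_def f1_def F0_def F1_def)
  have local: "step 3 (backward a b x) (backward a b y) + of_bool ((x, y) \<in> F1) =
      step 3 (forward a b x) (forward a b y) + of_bool ((x, y) \<in> F0)"
    if "x \<in> {a, b, c}" "y \<in> {a, b, c}" for x y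
    using that assms(1)
    by (auto simp: step_def forward_def backward_def F0_def F1_def)
  have "u ! k \<in> {a, b, c}" if "k < length u" for k
    using that nth_mem assms(3) by metis
  then have "(\<Sum>k<length u - 1. step 3 (backward a b (u ! k)) (backward a b (u ! Suc k)) +
      of_bool ((u ! k, u ! Suc k) \<in> F1)) =
    (\<Sum>k<length u - 1. step 3 (forward a b (u ! k)) (forward a b (u ! Suc k)) +
      of_bool ((u ! k, u ! Suc k) \<in> F0))"
    using local by (intro sum.cong) auto
  then show ?thesis by (simp add: travel_conv_sum f sum.distrib)
qed

text \<open>
  Let \<open>i\<close> and \<open>j\<close> be the times of the third and of the third to last term of a copy. All three letters
  of the copy have occurred by time \<open>i\<close> and occur again from time \<open>j\<close> on, so \<open>j + 3 \<le> i + m\<close>, and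
  the part of \<open>u\<close> in between travels at most \<open>m - 3\<close>. The two steps before and the two steps after
  it have length 1 if the copy runs forwards, which gives \<open>m + 1\<close> in total, less than the \<open>m + 2\<close>
  that \<open>u\<close> travels. They have length 2 if it runs backwards, which gives \<open>m + 5\<close>, less than the
  \<open>m + 2 + f0 u - f1 u\<close> needed then.
\<close>

lemma renewal_avoids:
  assumes abc: "distinct [a, b, c]" "set u = {a, b, c}" "u = [a, b, c] @ v"
    and xyz: "u = w @ [x, y, z]" "[x, y, z] \<in> {[a, b, c], [b, c, a], [c, a, b]}"
    and "5 \<le> length u" "f1 u + 4 \<le> f0 u" "travel 3 (map (forward a b) u) = m + 2" "m > 0"
  shows "avoids (map (renewal m) [0..<l]) u"
proof (rule ccontr)
  assume "\<not> ?thesis"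
  then obtain f where f: "inj_on f (set u)" "subseq (map f u) (map (renewal m) [0..<l])"
    by (rule not_avoidsE)
  obtain ts where ts: "map f u = map (renewal m) ts" "sorted_wrt (<) ts"
    using f(2) by (rule subseq_map_uptD)
  define n where "n = length u"
  have len: "length ts = n" "5 \<le> n" using ts(1) assms(6) n_def by (metis length_map)+
  have nth: "renewal m (ts ! k) = f (u ! k)" if "k < n" for k
    using that ts(1) len by (metis n_def nth_map)
  have mono: "ts ! k \<le> ts ! k'" if "k \<le> k'" "k' < n" for k k'
    using that ts(2) len sorted_wrt_nth_less[of "(<)" ts k k'] by (cases "k = k'") auto
  have start: "u ! 0 = a" "u ! 1 = b" "u ! 2 = c" using abc(3) by auto
  have final: "u ! (n - 3) = x" "u ! (n - 2) = y" "u ! (n - 1) = z" and lw: "n = length w + 3"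
    using xyz(1) by (auto simp: n_def nth_append)
  have letters: "{a, b, c} = {x, y, z}" using xyz(2) by auto
  define \<Lambda> where "\<Lambda> = f ` {a, b, c}"
  have card: "card \<Lambda> = 3" using f(1) abc(1,2) by (simp add: \<Lambda>_def card_image)
  define i j where "i = ts ! 2" and "j = ts ! (n - 3)"
  have ij: "i \<le> j" unfolding i_def j_def using len(2) by (intro mono) auto
  have before: "\<exists>e\<le>i. renewal m e = p" if "p \<in> \<Lambda>" for p
  proof -
    have "p = f (u ! 0) \<or> p = f (u ! 1) \<or> p = f (u ! 2)" using that start by (auto simp: \<Lambda>_def)
    then obtain k where "k \<le> 2" "p = f (u ! k)" by (metis le_numeral_extra(3) one_le_numeral order_refl zero_le)
    then show ?thesis using nth[of k] mono[of k 2] len by (auto simp: i_def j_def)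
  qed
  have after: "\<exists>e\<ge>j. renewal m e = p" if "p \<in> \<Lambda>" for p
  proof -
    have "p = f (u ! (n - 3)) \<or> p = f (u ! (n - 2)) \<or> p = f (u ! (n - 1))"
      using that final letters unfolding \<Lambda>_def by auto
    then have "\<exists>k. n - 3 \<le> k \<and> k < n \<and> p = f (u ! k)"
    proof (elim disjE)
      assume "p = f (u ! (n - 3))"
      then show ?thesis using len by (intro exI[of _ "n - 3"]) auto
    next
      assume "p = f (u ! (n - 2))"
      then show ?thesis using len by (intro exI[of _ "n - 2"]) auto
    next
      assume "p = f (u ! (n - 1))"
      then show ?thesis using len by (intro exI[of _ "n - 1"]) auto
    qed
    then obtain k where "n - 3 \<le> k" "k < n" "p = f (u ! k)" by blast
    then show ?thesis using nth[of k] mono[of "n - 3" k] len by (auto simp: i_def j_def)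
  qed
  note span = renewal_common_span[OF assms(9) card ij before after]
  \<comment> \<open>The place of a letter on the cycle is the common residue of its occurrences.\<close>
  define h where "h p = (SOME t. renewal m t = f p) mod 3" for p
  have h: "h p = t mod 3" if "renewal m t = f p" for p t
  proof -
    have "renewal m (SOME t. renewal m t = f p) = renewal m t"
      using someI[of "\<lambda>t. renewal m t = f p" t] that by simp
    then show ?thesis unfolding h_def by (rule renewal_mod_eq[OF assms(9)])
  qed
  have h_ts: "map h u = map (\<lambda>t. t mod 3) ts"
    using len h nth by (intro nth_equalityI) (auto simp: n_def)
  have inj: "inj_on h {a, b, c}"
  proof (rule inj_onI)
    fix p q assume pq: "p \<in> {a, b, c}" "q \<in> {a, b, c}" "h p = h q"
    then have "f p \<in> renewal m ` {i - 2, i - 1, i}" "f q \<in> renewal m ` {i - 2, i - 1, i}"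
      using span(2) unfolding \<Lambda>_def by blast+
    then obtain s t where st: "f p = renewal m s" "f q = renewal m t"
      "i \<le> s + 2" "s \<le> i" "i \<le> t + 2" "t \<le> i" using span(3) by auto
    then have "s mod 3 = t mod 3" using pq(3) h by metis
    then have "s = t" using mod3_gap[of s t] mod3_gap[of t s] st(3-6) by (cases s t rule: linorder_cases) auto
    then show "p = q" using st f(1) pq abc(2) by (auto simp: inj_on_def)
  qed
  have range: "h ` {a, b, c} \<subseteq> {..<3}" by (auto simp: h_def)
  obtain w' where w': "w = a # b # w'" using abc(3) xyz(1) lw len(2)
    by (cases w; cases "tl w") auto
  have u: "u = [a, b] @ (w' @ [x]) @ [y, z]" using xyz(1) w' by simp
  have hd: "hd (w' @ [x]) = c" using u abc(3) by (cases w') auto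
  define ts' where "ts' = drop 2 (take (n - 2) ts)"
  have "map (\<lambda>t. t mod 3) ts' = drop 2 (take (n - 2) (map h u))"
    unfolding ts'_def h_ts by (simp add: drop_map take_map)
  also have "n - 2 = Suc (Suc (Suc (length w')))" using lw w' by simp
  then have "drop 2 (take (n - 2) (map h u)) = map h (w' @ [x])"
    by (subst u) (simp add: numeral_2_eq_2)
  finally have mid: "map (\<lambda>t. t mod 3) ts' = map h (w' @ [x])" .
  have "Suc (Suc (length ts - 5)) = length ts - 3" using len by linarith
  then have "ts' \<noteq> []" "sorted_wrt (<) ts'" "hd ts' = i" "last ts' = j"
    using ts(2) len by (auto simp: ts'_def i_def j_def sorted_wrt_drop sorted_wrt_take hd_drop_conv_nth last_conv_nth)
  then have "i + travel 3 (map h (w' @ [x])) \<le> j"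
    using travel_le_span[of ts' 3] mid by simp
  then have short: "travel 3 (map h (w' @ [x])) + 3 \<le> m" using span(1) by linarith
  have total: "travel 3 (map h u) = step 3 (h a) (h b) + step 3 (h b) (h c) +
      travel 3 (map h (w' @ [x])) + step 3 (h x) (h y) + step 3 (h y) (h z)"
  proof -
    have "travel 3 (map h u) = travel 3 ([h a, h b] @ map h (w' @ [x]) @ [h y, h z])"
      by (subst u) simp
    also have "\<dots> = travel 3 [h a, h b] + step 3 (h b) (hd (map h (w' @ [x]))) +
        (travel 3 (map h (w' @ [x])) + step 3 (h x) (h y) + travel 3 [h y, h z])"
      by (subst travel_append, simp, simp, subst travel_append) (simp_all add: hd_append)
    also have "hd (map h (w' @ [x])) = h c" using hd by (simp add: hd_map del: map_append)
    finally show ?thesis by simp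
  qed
  have mem: "x \<in> {a, b, c}" "y \<in> {a, b, c}" "z \<in> {a, b, c}" using letters by auto
  from three_labellings[OF abc(1) inj range] show False
  proof
    assume *: "\<forall>x\<in>{a, b, c}. \<forall>y\<in>{a, b, c}.
      step 3 (h x) (h y) = step 3 (forward a b x) (forward a b y)"
    then have "travel 3 (map h u) = travel 3 (map (forward a b) u)"
      using abc(2) by (intro travel_map_cong) blast
    then have "travel 3 (map h u) = m + 2" using assms(8) by simp
    moreover have "step 3 (h a) (h b) = 1" "step 3 (h b) (h c) = 1"
      "step 3 (h x) (h y) = 1" "step 3 (h y) (h z) = 1"
      using * mem xyz(2) abc(1) by (auto simp: forward_def step_def)
    ultimately show False using total short by linarith
  next
    assume *: "\<forall>x\<in>{a, b, c}. \<forall>y\<in>{a, b, c}.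
      step 3 (h x) (h y) = step 3 (backward a b x) (backward a b y)"
    then have "travel 3 (map h u) = travel 3 (map (backward a b) u)"
      using abc(2) by (intro travel_map_cong) blast
    then have "travel 3 (map h u) + f1 u = m + 2 + f0 u"
      using f_diff_eq_travel_diff[OF abc(1,3,2)] assms(8) by simp
    moreover have "step 3 (h a) (h b) = 2" "step 3 (h b) (h c) = 2"
      "step 3 (h x) (h y) = 2" "step 3 (h y) (h z) = 2"
      using * mem xyz(2) abc(1) by (auto simp: backward_def step_def)
    ultimately show False using total short assms(7) by linarith
  qed
qed

lemma renewal_stretch:
  assumes "m > 0" "3 \<le> k * m"
  defines "\<phi> \<equiv> \<lambda>t. renewal m (k * m - 2 + t)"
  shows "map (renewal m) [k * m - 2..<Suc k * m] = map (\<lambda>t. \<phi> (t mod 3)) [0..<m + 2]"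
    and "inj_on \<phi> {..<3}"
proof -
  show "map (renewal m) [k * m - 2..<Suc k * m] = map (\<lambda>t. \<phi> (t mod 3)) [0..<m + 2]"
  proof -
    have "Suc k * m = (m + 2) + (k * m - 2)" using assms(2) by simp
    then have "[k * m - 2..<Suc k * m] = map (\<lambda>i. i + (k * m - 2)) [0..<m + 2]"
      by (simp only: map_add_upt)
    then have "map (renewal m) [k * m - 2..<Suc k * m] =
        map (\<lambda>t. renewal m (k * m - 2 + t)) [0..<m + 2]"
      by (simp add: comp_def add.commute del: upt_Suc mult_Suc)
    also have "\<dots> = map (\<lambda>t. \<phi> (t mod 3)) [0..<m + 2]"
      unfolding \<phi>_def by (intro map_cong refl renewal_periodic[OF assms(1,2)]) auto
    finally show ?thesis .
  qed
  show "inj_on \<phi> {..<3}"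
  proof (rule inj_onI)
    fix s t :: nat assume "s \<in> {..<3}" "t \<in> {..<3}" "\<phi> s = \<phi> t"
    then show "s = t"
      using renewal_distinct[OF assms(1), of "k * m - 2 + s" "k * m - 2 + t"]
        renewal_distinct[OF assms(1), of "k * m - 2 + t" "k * m - 2 + s"]
      by (cases s t rule: linorder_cases) (auto simp: \<phi>_def)
  qed
qed

text \<open>
  In the cycle, \<open>k + 2\<close> is the letter that precedes the first term of the stretch around its birth.
\<close>

lemma renewal_birth_copy:
  assumes "inj_on g (set u)" "g ` set u \<subseteq> {..<3}" "u \<noteq> []" "travel 3 (map g u) = m + 2"
    and k: "m > 0" "3 \<le> k * m"
  shows "\<not> avoids ((k + 2) # map (renewal m) [k * m - 2..<Suc k * m]) u"
proof -
  define \<phi> where "\<phi> t = renewal m (k * m - 2 + t)" for t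
  note stretch = renewal_stretch[OF k, folded \<phi>_def]
  have "k * m - 2 + 2 = k * m" using k(2) by linarith
  then have "\<phi> 2 = renewal m (k * m)" by (simp only: \<phi>_def)
  then have "\<phi> 2 = k + 2" using k renewal_fresh[of "k * m" m] by simp
  moreover have upt: "[2..<2 + Suc (m + 2)] = 2 # map (\<lambda>i. i + 3) [0..<m + 2]"
  proof -
    have "2 + Suc (m + 2) = m + 5" "m + 2 + 3 = m + 5" "Suc 2 = 3" by simp_all
    then show ?thesis using upt_conv_Cons[of 2 "m + 5"] by (simp only: map_add_upt)
  qed
  ultimately have "(k + 2) # map (renewal m) [k * m - 2..<Suc k * m] =
      map (\<lambda>t. \<phi> (t mod 3)) [2..<2 + Suc (m + 2)]"
    unfolding stretch(1) upt by (simp add: comp_def del: upt_Suc)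
  moreover obtain f where "inj_on f (set u)"
    "subseq (map f u) (map (\<lambda>t. \<phi> (t mod 3)) [2..<2 + Suc (travel 3 (map g u))])"
    by (rule copy_in_periodic[OF assms(3,1,2) stretch(2), of 2])
  ultimately show ?thesis using not_avoidsI assms(4) by metis
qed

text \<open>
  At time \<open>Suc k * m\<close> the letter from three places before is replaced, and had it been repeated
  instead, a copy of \<open>u\<close> would be complete.
\<close>

lemma renewal_death_copy:
  assumes "inj_on g (set u)" "g ` set u \<subseteq> {..<3}" "u \<noteq> []" "travel 3 (map g u) = m + 2"
    and k: "m > 0" "3 \<le> k * m"
  shows "\<not> avoids (map (renewal m) [k * m - 2..<Suc k * m] @ [renewal m (Suc k * m - 3)]) u"
proof -
  define \<phi> where "\<phi> t = renewal m (k * m - 2 + t)" for t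
  note stretch = renewal_stretch[OF k, folded \<phi>_def]
  have "Suc k * m - 3 = k * m - 2 + (m - 1)" using k by simp
  then have "renewal m (Suc k * m - 3) = \<phi> ((m - 1) mod 3)"
    using renewal_periodic[OF k, of "m - 1"] by (simp add: \<phi>_def)
  also have "(m - 1) mod 3 = (m - 1 + 3) mod 3" by simp
  also have "m - 1 + 3 = m + 2" using k(1) by simp
  finally have "map (renewal m) [k * m - 2..<Suc k * m] @ [renewal m (Suc k * m - 3)] =
      map (\<lambda>t. \<phi> (t mod 3)) [0..<0 + Suc (m + 2)]"
    unfolding stretch(1) by simp
  moreover obtain f where "inj_on f (set u)"
    "subseq (map f u) (map (\<lambda>t. \<phi> (t mod 3)) [0..<0 + Suc (travel 3 (map g u))])"
    by (rule copy_in_periodic[OF assms(3,1,2) stretch(2), of 0])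
  ultimately show ?thesis using not_avoidsI assms(4) by metis
qed

text \<open>
  The letter \<open>q + 2\<close> creates a copy when it is inserted before the two terms that precede its birth
  in block \<open>q\<close>, or after its replacement, which happens at the start of block \<open>q + 3\<close> or
  earlier. So only the letters \<open>k, \<dots>, k + 3\<close> can enter at block \<open>k\<close>. The letters \<open>0, \<dots>, 3\<close> are left
  free: \<open>0, 1, 2\<close> start the sequence, and \<open>3\<close> is skipped if \<open>m = 2\<close>.
\<close>

lemma cyclic_linear:
  fixes u :: "'a list"
  assumes "cyclic_abc_xyz u" "f1 u + 4 \<le> f0 u"
  shows "(\<lambda>n. real (Sat n u)) \<in> O(\<lambda>n. real n)"
proof -
  obtain a b c x y z v w where abc: "distinct [a, b, c]" "u = [a, b, c] @ v"
    and xyz: "u = w @ [x, y, z]" "[x, y, z] \<in> {[a, b, c], [b, c, a], [c, a, b]}"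
    and card: "card (set u) = 3" using assms(1) unfolding cyclic_abc_xyz_def by blast
  have u: "u \<noteq> []" using abc by simp
  have set: "set u = {a, b, c}"
    by (rule card_seteq[symmetric]) (use abc card in auto)
  have "f0 u \<le> card {..<length u - 1}"
    unfolding f0_def Let_def by (intro card_mono) auto
  then have len: "5 \<le> length u" using assms(2) by simp
  define g where "g = forward a b"
  have g: "inj_on g (set u)" "g ` set u \<subseteq> {..<3}"
    using abc(1) by (auto simp: set g_def forward_def inj_on_def)
  define m where "m = travel 3 (map g u) - 2"
  have m: "travel 3 (map g u) = m + 2" "2 \<le> m"
    using travel_ge_length[of "map g u" 3] g(2) len by (auto simp: m_def)
  have m0: "m > 0" using m(2) by simp
  have avoid: "avoids (map (renewal m) [0..<l]) u" for l
    using renewal_avoids[OF abc(1) set abc(2) xyz len assms(2)] m(1) m0 unfolding g_def by blast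
  show ?thesis
  proof (rule Sat_linear_by_blocks[where s = "renewal m" and c = "\<lambda>k. k * m" and nmin = 4
        and M = "\<lambda>n. n - 2" and L = "\<lambda>n k. {..<4} \<union> {k..<k + 4}" and K = 8])
    show "mono (\<lambda>k. k * m)" by (intro monoI) simp
    show "sparse (card (set u)) (map (renewal m) [0..<l])" for l
      using renewal_distinct[OF m0] unfolding card by (intro sparse_map_uptI) auto
    show "renewal m ` {..<(n - 2) * m} \<subseteq> {..<n}" if "4 \<le> n" for n
    proof safe
      fix t assume "t < (n - 2) * m"
      then have "t div m < n - 2" by (simp add: less_mult_imp_div_less)
      then show "renewal m t < n" using renewal_le[of m t] by linarith
    qed
    show "finite ({..<4} \<union> {k..<k + 4}) \<and> card ({..<4} \<union> {k..<k + 4}) \<le> 8" for k :: nat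
      using card_Un_le[of "{..<4}" "{k..<k + 4}"] by simp
    fix n k x :: nat assume n: "4 \<le> n" and k: "k \<le> n - 2" and x: "x < n" "x \<notin> {..<4} \<union> {k..<k + 4}"
    define q where "q = x - 2"
    have q: "x = q + 2" "2 \<le> q" using x by (auto simp: q_def)
    have qm: "3 \<le> q * m" using mult_le_mono[OF q(2) m(2)] by simp
    consider "k + 2 \<le> q" | "q + 3 \<le> k" using x(2) q by fastforce
    then show "\<not> avoids (map (renewal m) [0..<k * m] @ x # map (renewal m) [Suc k * m..<(n - 2) * m]) u"
    proof cases
      case 1
      have "(k + 2) * m \<le> q * m" "Suc q * m \<le> (n - 2) * m"
        using 1 x q by (auto intro!: mult_le_mono1 simp del: mult_Suc)
      then have "subseq (map (renewal m) [q * m - 2..<Suc q * m])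
          (map (renewal m) [Suc k * m..<(n - 2) * m])"
        using m(2) by (intro subseq_map_upt_mono) auto
      then have "subseq (x # map (renewal m) [q * m - 2..<Suc q * m])
          (map (renewal m) [0..<k * m] @ x # map (renewal m) [Suc k * m..<(n - 2) * m])"
        by (intro list_emb_append2) simp
      moreover have "\<not> avoids (x # map (renewal m) [q * m - 2..<Suc q * m]) u"
        using renewal_birth_copy[OF g u m(1) m0 qm] unfolding q(1) .
      ultimately show ?thesis using avoids_subseq by blast
    next
      case 2
      obtain k' where k': "q < k'" "k' \<le> q + 3" "renewal m (k' * m - 3) = x"
        using renewal_last_occurrence[OF m0 qm] q(1) by metis
      define p where "p = k' - 1"
      have p: "k' = Suc p" "2 \<le> p" "Suc p \<le> k" using k' q 2 by (auto simp: p_def)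
      have pm: "3 \<le> p * m" using mult_le_mono[OF p(2) m(2)] by simp
      have "Suc p * m \<le> k * m" using p(3) by (intro mult_le_mono1)
      then have "subseq (map (renewal m) [p * m - 2..<Suc p * m] @ [x])
          (map (renewal m) [0..<k * m] @ x # map (renewal m) [Suc k * m..<(n - 2) * m])"
        by (intro list_emb_append_mono subseq_map_upt_mono) auto
      moreover have "\<not> avoids (map (renewal m) [p * m - 2..<Suc p * m] @ [x]) u"
        using renewal_death_copy[OF g u m(1) m0 pm] unfolding p(1)[symmetric] k'(3) .
      ultimately show ?thesis using avoids_subseq by blast
    qed
  qed (use u avoid in auto)
qed

section \<open>Alternating sequences\<close>

text \<open>
  Alternating sequences are prefixes of the periodic sequence \<open>abcabc\<dots>\<close>; their length decides how
  they are treated. The sequence \<open>abcab\<close> is the shortest one with \<open>f0 u \<ge> f1 u + 4\<close>.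
\<close>

lemma seq_power_nth:
  "seq_power [a, b, c] t = map (\<lambda>k. [a, b, c] ! (k mod 3)) [0..<3 * t]"
proof (induction t)
  case (Suc t)
  have "seq_power [a, b, c] (Suc t) = seq_power [a, b, c] t @ [a, b, c]"
    unfolding seq_power_def
    by (simp only: replicate_Suc replicate_append_same[symmetric] concat_append concat.simps append_Nil2)
  moreover have "[0..<3 * Suc t] = [0..<3 * t] @ [3 * t, 3 * t + 1, 3 * t + 2]"
  proof -
    have "3 * Suc t = Suc (Suc (Suc (3 * t)))" by simp
    then show ?thesis by (simp only: upt_Suc) simp
  qed
  ultimately show ?case using Suc by (simp add: mod_Suc)
qed (simp add: seq_power_def)

lemma alternating_nth:
  assumes "alternating_abc u"
  obtains a b c l where "distinct [a, b, c]" "3 \<le> l" "u = map (\<lambda>k. [a, b, c] ! (k mod 3)) [0..<l]"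
proof -
  obtain a b c t where t: "distinct [a, b, c]" "1 \<le> t"
    "u \<in> {seq_power [a, b, c] t, seq_power [a, b, c] t @ [a], seq_power [a, b, c] t @ [a, b]}"
    using assms unfolding alternating_abc_def by blast
  have "\<exists>l\<ge>3 * t. u = map (\<lambda>k. [a, b, c] ! (k mod 3)) [0..<l]"
  proof -
    from t(3) consider "u = seq_power [a, b, c] t" | "u = seq_power [a, b, c] t @ [a]"
      | "u = seq_power [a, b, c] t @ [a, b]" by auto
    then show ?thesis
    proof cases
      case 1
      then show ?thesis by (auto simp: seq_power_nth)
    next
      case 2
      then show ?thesis by (intro exI[of _ "Suc (3 * t)"]) (simp add: seq_power_nth)
    next
      case 3
      then show ?thesis
        by (intro exI[of _ "Suc (Suc (3 * t))"]) (simp add: seq_power_nth mod_Suc)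
    qed
  qed
  then obtain l where l: "3 * t \<le> l" "u = map (\<lambda>k. [a, b, c] ! (k mod 3)) [0..<l]" by blast
  show thesis by (rule that[OF t(1) _ l(2)]) (use t(2) l(1) in linarith)
qed

lemma long_alternating_cyclic:
  assumes "distinct [a, b, c]" "5 \<le> l" "u = map (\<lambda>k. [a, b, c] ! (k mod 3)) [0..<l]"
  shows "cyclic_abc_xyz u" "f1 u + 4 \<le> f0 u"
proof -
  define s where "s k = [a, b, c] ! (k mod 3)" for k
  have u: "u = map s [0..<l]" using assms(3) by (simp add: s_def)
  have cases: "(s k, s (Suc k)) \<in> {(a, b), (b, c), (c, a)}" for k
  proof -
    have "k mod 3 = 0 \<or> k mod 3 = 1 \<or> k mod 3 = 2" by linarith
    then show ?thesis by (auto simp: s_def mod_Suc)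
  qed
  have "Suc k < length u \<and> (u ! k, u ! Suc k) \<in> {(a, b), (b, c), (c, a)} \<longleftrightarrow> k < l - 1" for k
    using cases[of k] by (auto simp: u)
  then have "{k. Suc k < length u \<and> (u ! k, u ! Suc k) \<in> {(a, b), (b, c), (c, a)}} = {..<l - 1}"
    by blast
  moreover have start: "u ! 0 = a" "u ! 1 = b" "u ! 2 = c"
    using assms(2) by (simp_all add: u s_def)
  ultimately have f0: "f0 u = l - 1" unfolding f0_def Let_def start by simp
  have "(s k, s (Suc k)) \<notin> {(a, c), (b, a), (c, b)}" for k
    using cases[of k] assms(1) by auto
  then have "{k. Suc k < length u \<and> (u ! k, u ! Suc k) \<in> {(a, c), (b, a), (c, b)}} = {}"
    by (auto simp: u)
  then have f1: "f1 u = 0" unfolding f1_def Let_def start by (simp only: card.empty)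
  show "f1 u + 4 \<le> f0 u" using f0 f1 assms(2) by simp
  have "s k \<in> {a, b, c}" for k using cases[of k] by auto
  moreover have "{a, b, c} \<subseteq> set u"
    using start assms(2) nth_mem[of 0 u] nth_mem[of 1 u] nth_mem[of 2 u] by (auto simp: u)
  ultimately have "set u = {a, b, c}" by (auto simp: u)
  then have "card (set u) = 3" using assms(1) by simp
  moreover have "u = [a, b, c] @ map s [3..<l]"
    using upt_split[of 0 3 l] assms(2) unfolding u by (simp add: s_def upt_rec)
  moreover define p where "p = l - 3"
  then have "l = Suc (Suc (Suc p))" using assms(2) by simp
  then have "u = map s [0..<p] @ [s p, s (Suc p), s (Suc (Suc p))]"
    unfolding u by simp
  moreover have "[s p, s (Suc p), s (Suc (Suc p))] \<in> {[a, b, c], [b, c, a], [c, a, b]}"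
    using cases[of p] cases[of "Suc p"] assms(1) by auto
  ultimately show "cyclic_abc_xyz u" unfolding cyclic_abc_xyz_def using assms(1) by metis
qed

lemma short_alternating_linear:
  fixes u :: "'a list"
  assumes "distinct [a, b, c]" "subseq u [a, b, c, a]" "set u = {a, b, c}"
  shows "(\<lambda>n. real (Sat n u)) \<in> O(\<lambda>n. real n)"
proof -
  have "Sat n u \<le> n" for n
  proof -
    have "u \<noteq> []" using assms(3) by auto
    then obtain z where z: "saturated {..<n} u z" "length z = Sat n u"
      using Sat_attained by blast
    have "card (set u) = 3" using assms(1,3) by simp
    then have zP: "set z \<subseteq> {..<n}" "sparse 3 z" "avoids z u"
      using z(1) unfolding saturated_def by auto
    have "z ! i \<noteq> z ! j" if "i < j" "j < length z" for i j
    proof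
      assume eq: "z ! i = z ! j"
      then have far: "i + 3 \<le> j" using sparseD[OF zP(2) that] by force
      \<comment> \<open>The letters at \<open>i\<close>, \<open>i + 1\<close>, \<open>i + 2\<close> and the repetition at \<open>j\<close> form a copy of \<open>abca\<close>.\<close>
      define f where "f p = z ! (i + forward a b p)" for p
      have "z ! i \<noteq> z ! (i + 1)" "z ! i \<noteq> z ! (i + 2)" "z ! (i + 1) \<noteq> z ! (i + 2)"
        using sparseD[OF zP(2), of i "i + 1"] sparseD[OF zP(2), of i "i + 2"]
          sparseD[OF zP(2), of "i + 1" "i + 2"] far that by auto
      then have "inj_on f (set u)"
        using assms(1) by (auto simp: assms(3) f_def forward_def inj_on_def)
      moreover have "map f [a, b, c, a] = map ((!) z) [i, i + 1, i + 2, j]"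
        using assms(1) eq by (auto simp: f_def forward_def)
      moreover have "subseq (map ((!) z) [i, i + 1, i + 2, j]) (map ((!) z) [0..<length z])"
        using far that by (intro subseq_map subseq_uptI) auto
      moreover have "subseq (map f u) (map f [a, b, c, a])"
        using assms(2) by (rule subseq_map)
      ultimately show False
        using not_avoidsI zP(3) by (metis map_nth subseq_order.order_trans)
    qed
    then have "distinct z" by (metis distinct_conv_nth nat_neq_iff)
    then have "length z \<le> card {..<n}"
      using zP(1) by (metis card_mono distinct_card finite_lessThan)
    then show ?thesis using z(2) by simp
  qed
  then show ?thesis by (intro bigoI[of _ 1] always_eventually) auto
qed

lemma alternating_linear:
  fixes u :: "'a list"
  assumes "alternating_abc u"
  shows "(\<lambda>n. real (Sat n u)) \<in> O(\<lambda>n. real n)"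
proof -
  obtain a b c l where abc: "distinct [a, b, c]" and l: "3 \<le> l"
    and u: "u = map (\<lambda>k. [a, b, c] ! (k mod 3)) [0..<l]"
    using assms by (rule alternating_nth)
  show ?thesis
  proof (cases "5 \<le> l")
    case True
    then show ?thesis using long_alternating_cyclic[OF abc True u] by (intro cyclic_linear)
  next
    case False
    then have "l = 3 \<or> l = 4" using l by linarith
    then have "u = [a, b, c] \<or> u = [a, b, c, a]" by (auto simp: u upt_rec)
    then show ?thesis using abc by (intro short_alternating_linear[OF abc]) auto
  qed
qed

theorem theorem1:
  fixes u :: "'a list"
  assumes "alternating_abc u \<or>
           (doubled_ends u \<and> \<not> decomposable u) \<or>
           (cyclic_abc_xyz u \<and> f0 u \<ge> f1 u + 5)"
  shows "(\<lambda>n. real (Sat n u)) \<in> O(\<lambda>n. real n)"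
  using assms
proof (elim disjE conjE)
  assume "cyclic_abc_xyz u" "f0 u \<ge> f1 u + 5"
  then show ?thesis by (intro cyclic_linear) auto
qed (rule alternating_linear doubled_ends_linear; assumption)+

end
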